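(* Let $n\ge1$, let $\alpha=(\alpha_1,\dots,\alpha_n),\beta=(\beta_1,\dots,\beta_n)\in\{-1,1\}^n$, and let $f\in H^2(\mathbb{D}^n)^\alpha$ and $g\in H^2(\mathbb{D}^n)^\beta$. Then $$\left\langle P_{H^2(\mathbb{D}^n)}(fk_\xi),\,P_{H^2(\mathbb{D}^n)}(gk_\xi)\right\rangle\to f\overline{g}\quad\text{radially},$$ that is, for a.e. $(e^{i\theta_1},\dots,e^{i\theta_n})\in\mathbb{T}^n$, $$\left\langle P_{H^2(\mathbb{D}^n)}\big(fk_{(re^{i\theta_1},\dots,re^{i\theta_n})}\big),\,P_{H^2(\mathbb{D}^n)}\big(gk_{(re^{i\theta_1},\dots,re^{i\theta_n})}\big)\right\rangle\to f(e^{i\theta_1},\dots,e^{i\theta_n})\,\overline{g}(e^{i\theta_1},\dots,e^{i\theta_n})\quad\text{as } r\to1^-.$$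
   Context: Let $\mathbb{D}$ be the open unit disc, $\mathbb{T}$ the unit circle, $\mathfrak{m}_n$ the normalized Lebesgue measure on $\mathbb{T}^n$, and $L^2(\mathbb{T}^n)=L^2(\mathbb{T}^n,\mathfrak{m}_n)$ with orthonormal basis $e_k(\zeta)=\zeta_1^{k_1}\cdots\zeta_n^{k_n}$, $k\in\mathbb{Z}^n$. The Hardy space $H^2(\mathbb{D}^n)$ is identified, via radial boundary values, with the closed subspace of $L^2(\mathbb{T}^n)$ consisting of the functions $f$ with $\langle f,e_k\rangle=0$ for all $k\in\mathbb{Z}^n\setminus\mathbb{Z}_+^n$. $P_{H^2(\mathbb{D}^n)}$ is the orthogonal projection of $L^2(\mathbb{T}^n)$ onto $H^2(\mathbb{D}^n)$. For $\alpha\in\{-1,1\}^n$, $H^2(\mathbb{D}^n)^\alpha$ is the closed linear span in $L^2(\mathbb{T}^n)$ of all $e_k$, $k=(k_1,\dots,k_n)\in\mathbb{Z}^n$, such that for each $1\le j\le n$: $k_j<0$ if $\alpha_j=-1$, and $k_j\ge0$ if $\alpha_j=1$. For $\xi\in\mathbb{D}^n$, the normalized reproducing kernel of $H^2(\mathbb{D}^n)$ is $k_\xi(z)=\prod_{j=1}^n\frac{\sqrt{1-|\xi_j|^2}}{1-\overline{\xi_j}z_j}$, regarded also as a bounded function on $\mathbb{T}^n$. A function $\Phi(\xi)$ on $\mathbb{D}^n$ tends to $\phi$ radially if $\lim_{r\to1^-}\Phi(r\zeta)=\phi(\zeta)$ for a.e. $\zeta\in\mathbb{T}^n$. *)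

theory Defs
  imports "HOL-Analysis.Analysis"
begin

text \<open>
  The index type \<open>'n\<close> of class \<open>finite\<close> plays the role of \<open>{1, \<dots>, n}\<close>; points of
  \<open>\<complex>\<^sup>n\<close> are functions \<open>'n \<Rightarrow> complex\<close> and multi-indices in \<open>\<int>\<^sup>n\<close> are functions
  \<open>'n \<Rightarrow> int\<close>.  The underlying space of \<open>torus_measure\<close> is exactly the torus, so the values
  of a function off the torus are irrelevant.
\<close>

definition circle_measure :: "complex measure" where
  "circle_measure =
     distr (uniform_measure lborel {0..2 * pi}) (restrict_space borel (sphere 0 1)) cis"

definition torus_measure :: "('n::finite \<Rightarrow> complex) measure" where
  "torus_measure = PiM UNIV (\<lambda>_. circle_measure)"

text \<open>
  Elements of \<open>L\<^sup>2\<close> are represented by functions, not by classes modulo null sets; the sets of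
  functions \<open>L2_torus\<close>, \<open>hardy2\<close> and \<open>hardy2_sign\<close> below are closed under almost everywhere
  equality of measurable functions.
\<close>

definition L2_torus :: "(('n::finite \<Rightarrow> complex) \<Rightarrow> complex) set" where
  "L2_torus = {f. f \<in> borel_measurable torus_measure \<and>
                  integrable torus_measure (\<lambda>\<zeta>. (cmod (f \<zeta>))\<^sup>2)}"

definition L2_inner ::
    "(('n::finite \<Rightarrow> complex) \<Rightarrow> complex) \<Rightarrow> (('n \<Rightarrow> complex) \<Rightarrow> complex) \<Rightarrow> complex" where
  "L2_inner f g = (LINT \<zeta>|torus_measure. f \<zeta> * cnj (g \<zeta>))"

definition L2_norm :: "(('n::finite \<Rightarrow> complex) \<Rightarrow> complex) \<Rightarrow> real" where
  "L2_norm f = sqrt (LINT \<zeta>|torus_measure. (cmod (f \<zeta>))\<^sup>2)"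

definition monom_e :: "('n::finite \<Rightarrow> int) \<Rightarrow> ('n \<Rightarrow> complex) \<Rightarrow> complex" where
  "monom_e k \<zeta> = (\<Prod>j\<in>UNIV. \<zeta> j powi k j)"

definition hardy2 :: "(('n::finite \<Rightarrow> complex) \<Rightarrow> complex) set" where
  "hardy2 = {f \<in> L2_torus. \<forall>k. \<not> (\<forall>j. 0 \<le> k j) \<longrightarrow> L2_inner f (monom_e k) = 0}"

text \<open>
  The orthogonal projection of \<open>f \<in> L\<^sup>2\<close>, determined up to a null set: a member of
  \<open>hardy2\<close> whose difference from \<open>f\<close> is orthogonal to \<open>hardy2\<close>.
\<close>

definition hardy2_proj ::
    "(('n::finite \<Rightarrow> complex) \<Rightarrow> complex) \<Rightarrow> ('n \<Rightarrow> complex) \<Rightarrow> complex" where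
  "hardy2_proj f =
     (SOME h. h \<in> hardy2 \<and> (\<forall>u\<in>hardy2. L2_inner (\<lambda>\<zeta>. f \<zeta> - h \<zeta>) u = 0))"

definition sign_indices :: "('n::finite \<Rightarrow> int) \<Rightarrow> ('n \<Rightarrow> int) set" where
  "sign_indices \<alpha> = {k. \<forall>j. (\<alpha> j = -1 \<longrightarrow> k j < 0) \<and> (\<alpha> j = 1 \<longrightarrow> 0 \<le> k j)}"

definition monom_span :: "('n::finite \<Rightarrow> int) set \<Rightarrow> (('n \<Rightarrow> complex) \<Rightarrow> complex) set" where
  "monom_span K = {(\<lambda>\<zeta>. \<Sum>k\<in>S. c k * monom_e k \<zeta>) | S c. finite S \<and> S \<subseteq> K}"

definition hardy2_sign :: "('n::finite \<Rightarrow> int) \<Rightarrow> (('n \<Rightarrow> complex) \<Rightarrow> complex) set" where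
  "hardy2_sign \<alpha> =
     {f \<in> L2_torus. \<forall>\<epsilon>>0. \<exists>p\<in>monom_span (sign_indices \<alpha>). L2_norm (\<lambda>\<zeta>. f \<zeta> - p \<zeta>) < \<epsilon>}"

definition norm_kernel :: "('n::finite \<Rightarrow> complex) \<Rightarrow> ('n \<Rightarrow> complex) \<Rightarrow> complex" where
  "norm_kernel \<xi> z =
     (\<Prod>j\<in>UNIV. complex_of_real (sqrt (1 - (cmod (\<xi> j))\<^sup>2)) / (1 - cnj (\<xi> j) * z j))"

text \<open>Here \<open>\<Phi>\<close> only matters on the open polydisc, where \<open>r\<zeta>\<close> lies for \<open>0 \<le> r < 1\<close>.\<close>

definition tends_radially ::
    "(('n::finite \<Rightarrow> complex) \<Rightarrow> complex) \<Rightarrow> (('n \<Rightarrow> complex) \<Rightarrow> complex) \<Rightarrow> bool" where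
  "tends_radially \<Phi> \<phi> \<longleftrightarrow>
     (AE \<zeta> in torus_measure.
        ((\<lambda>r::real. \<Phi> (\<lambda>j. complex_of_real r * \<zeta> j)) \<longlongrightarrow> \<phi> \<zeta>) (at_left 1))"

end

theory Submission
  imports Defs "HOL-Complex_Analysis.Complex_Analysis" "HOL-Probability.Probability"
begin

text \<open>
  The kernel \<open>k = norm_kernel \<xi>\<close> at \<open>\<xi> = r\<zeta>\<close> is a unit vector of \<open>hardy2\<close>, and \<open>\<bar>k\<bar>\<^sup>2\<close> is the Poisson
  kernel of the polydisc with pole \<open>\<zeta>\<close> and the same radius \<open>r\<close> in every variable.  Write \<open>P\<close>
  for the orthogonal projection onto \<open>hardy2\<close>.  For a constant \<open>c\<close> we have
  \<open>P (f k) = c k + P ((f - c) k)\<close>, and since \<open>P\<close> is a contraction,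
  \<open>\<parallel>P ((f - c) k)\<parallel>\<^sup>2 \<le> \<integral> \<bar>f - c\<bar>\<^sup>2 \<bar>k\<bar>\<^sup>2\<close>, which is the Poisson integral of \<open>\<bar>f - c\<bar>\<^sup>2\<close> at \<open>\<xi>\<close>.
  Taking \<open>c = f \<zeta>\<close>, and \<open>g \<zeta>\<close> for \<open>g\<close>, the inner product in question differs from
  \<open>f \<zeta> * cnj (g \<zeta>)\<close> by an amount that tends to \<open>0\<close> as soon as \<open>\<zeta>\<close> is a Lebesgue point of \<open>f\<close> and of
  \<open>g\<close> in the sense that the Poisson integral of \<open>\<bar>f - f \<zeta>\<bar>\<^sup>2\<close> at \<open>r\<zeta>\<close> tends to \<open>0\<close>
  (\<open>hardy2_proj_minus_multiple\<close>, \<open>inner_hardy2_proj_approx\<close>).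

  That almost every point is such a Lebesgue point (\<open>poisson_lebesgue_points\<close>) is clear for
  trigonometric polynomials.  It passes to their \<open>L\<^sup>2\<close> limits because the radial maximal
  function \<open>sup\<^sub>r\<close> of the Poisson integrals of an integrable function is of weak type \<open>(1,1)\<close>
  (\<open>poisson_maximal_weak_type\<close>).  The maximal estimate needs no covering argument.  The product
  Poisson kernels with equal radii form a semigroup under multiplication of radii, they are positive and
  preserve constants and integrals, so Hopf's maximal ergodic theorem bounds the ergodic averages of the
  powers of one of them.  By the Harnack inequality each single Poisson integral of a
  nonnegative function is bounded by such an average up to a factor depending on the dimension only.

  Finally, \<open>hardy2_proj\<close> is defined by choice, so that a projection must be shown to exist; this is the
  projection theorem for closed subspaces of \<open>L\<^sup>2\<close>, which rests on the completeness of \<open>L\<^sup>2\<close>.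
\<close>

section \<open>Integration over the circle and the Poisson kernel of the disc\<close>

lemma space_circle_measure [simp]: "space circle_measure = sphere 0 1"
  by (simp add: circle_measure_def)

lemma sets_circle_measure [measurable_cong]:
  "sets circle_measure = sets (restrict_space borel (sphere 0 1))"
  by (simp add: circle_measure_def)

lemma measurable_cis_circle: "cis \<in> borel \<rightarrow>\<^sub>M restrict_space borel (sphere 0 1)"
  by (intro measurable_restrict_space2 borel_measurable_continuous_onI continuous_on_cis continuous_intros)
     auto

lemma prob_space_circle_measure: "prob_space circle_measure"
  unfolding circle_measure_def
proof (rule prob_space.prob_space_distr)
  show "prob_space (uniform_measure lborel {0..2 * pi})"
    by (rule prob_space_uniform_measure) auto
  show "cis \<in> uniform_measure lborel {0..2 * pi} \<rightarrow>\<^sub>M restrict_space borel (sphere 0 1)"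
    using measurable_cis_circle by simp
qed

lemma borel_measurable_circle_id [measurable]: "(\<lambda>w. w) \<in> borel_measurable circle_measure"
  by (simp add: measurable_cong_sets[OF sets_circle_measure refl] measurable_restrict_space1)

lemma borel_measurable_circle_continuous:
  fixes F :: "complex \<Rightarrow> 'a::topological_space"
  assumes "continuous_on (sphere 0 1) F"
  shows "F \<in> borel_measurable circle_measure"
  using borel_measurable_continuous_on_restrict[OF assms]
  by (simp add: measurable_cong_sets[OF sets_circle_measure refl])

lemma integrable_circle_continuous:
  fixes F :: "complex \<Rightarrow> 'a::{banach, second_countable_topology}"
  assumes "continuous_on (sphere 0 1) F"
  shows "integrable circle_measure F"
proof -
  interpret prob_space circle_measure by (rule prob_space_circle_measure)
  have "bounded (F ` sphere 0 1)"
    by (intro compact_imp_bounded compact_continuous_image assms compact_sphere)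
  then obtain B where "\<forall>w\<in>sphere 0 1. norm (F w) \<le> B"
    unfolding bounded_iff by blast
  then show ?thesis
    by (intro integrable_const_bound[where B = B] borel_measurable_circle_continuous assms AE_I2) auto
qed

text \<open>
  Stated with a Henstock-Kurzweil integral over the parameter interval because contour integrals over
  circles unfold to such integrals.
\<close>

lemma integral_circle_measure:
  fixes F :: "complex \<Rightarrow> complex"
  assumes cont: "continuous_on (sphere 0 1) F"
    and I: "((\<lambda>t. F (cis t)) has_integral I) {0..2 * pi}"
  shows "(LINT w|circle_measure. F w) = I / (2 * pi)"
proof -
  have eq: "uniform_measure lborel {0..2 * pi} =
      density lborel (\<lambda>t. ennreal (indicator {0..2 * pi} t / (2 * pi)))"
    unfolding uniform_measure_def
    by (intro density_cong) (auto simp: indicator_def simp flip: divide_ennreal)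
  have cis_cont: "continuous_on {0..2 * pi} (\<lambda>t. F (cis t))"
    by (rule continuous_on_compose2[OF cont]) (auto intro!: continuous_intros continuous_on_cis)
  have set_int: "set_integrable lborel {0..2 * pi} (\<lambda>t. F (cis t))"
    unfolding set_integrable_def by (intro borel_integrable_compact cis_cont compact_Icc)
  have meas: "(\<lambda>t. F (cis t)) \<in> borel_measurable lborel"
    using measurable_compose[OF measurable_cis_circle borel_measurable_continuous_on_restrict[OF cont]]
    by simp
  have "(LINT w|circle_measure. F w) = (LINT t|uniform_measure lborel {0..2 * pi}. F (cis t))"
    unfolding circle_measure_def
    using measurable_cis_circle borel_measurable_continuous_on_restrict[OF cont]
    by (intro integral_distr) auto
  also have "\<dots> = (LINT t|lborel. (indicator {0..2 * pi} t / (2 * pi)) *\<^sub>R F (cis t))"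
    unfolding eq using meas by (intro integral_density) auto
  also have "\<dots> = (LINT t|lborel. (1 / (2 * pi)) *\<^sub>R (indicator {0..2 * pi} t *\<^sub>R F (cis t)))"
    by (intro Bochner_Integration.integral_cong) auto
  also have "\<dots> = (1 / (2 * pi)) *\<^sub>R (LINT t:{0..2 * pi}|lborel. F (cis t))"
    unfolding set_lebesgue_integral_def by (rule integral_scaleR_right)
  also have "(LINT t:{0..2 * pi}|lborel. F (cis t)) = I"
    using set_borel_integral_eq_integral(2)[OF set_int] I by (simp add: integral_unique)
  finally show ?thesis by (simp add: scaleR_conv_of_real)
qed

lemma one_minus_mult_nonzero:
  fixes a w :: complex
  assumes a: "cmod a < 1" and w: "cmod w \<le> 1"
  shows "1 - a * w \<noteq> 0"
proof
  assume "1 - a * w = 0"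
  then have "cmod a * cmod w = 1"
    by (metis eq_iff_diff_eq_0 norm_mult norm_one)
  moreover have "cmod a * cmod w \<le> cmod a"
    using w by (simp add: mult_left_le)
  ultimately show False using a by simp
qed

text \<open>
  On the unit circle \<open>1 / (1 - a * cnj w) = w / (w - a)\<close>, so this is Cauchy's integral formula, the
  factor \<open>w\<close> being absorbed by \<open>dw = \<i> w dt\<close>.
\<close>

lemma circle_Cauchy_formula:
  fixes F :: "complex \<Rightarrow> complex"
  assumes F: "F holomorphic_on cball 0 1" and a: "cmod a < 1"
  shows "(LINT w|circle_measure. F w / (1 - a * cnj w)) = F a"
proof -
  have nz: "1 - a * cnj w \<noteq> 0" if "cmod w = 1" for w
    using one_minus_mult_nonzero[OF a, of "cnj w"] that by simp
  have cont: "continuous_on (sphere 0 1) (\<lambda>w. F w / (1 - a * cnj w))"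
    using nz F
    by (intro continuous_intros holomorphic_on_imp_continuous_on
        holomorphic_on_subset[OF F]) auto
  have "((\<lambda>u. F u / (u - a)) has_contour_integral (2 * of_real pi * \<i> * F a)) (circlepath 0 1)"
    using Cauchy_integral_circlepath_simple[OF F, of a] a by simp
  then have "((\<lambda>t. F (cis t) / (cis t - a) * \<i> * cis t) has_integral 2 * of_real pi * \<i> * F a) {0..2 * pi}"
    unfolding circlepath_def by (simp add: has_contour_integral_part_circlepath_iff)
  then have "((\<lambda>t. (- \<i>) * (F (cis t) / (cis t - a) * \<i> * cis t))
      has_integral (- \<i>) * (2 * of_real pi * \<i> * F a)) {0..2 * pi}"
    by (rule has_integral_mult_right)
  also have "(- \<i>) * (2 * of_real pi * \<i> * F a) = 2 * of_real pi * F a"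
    by (simp add: algebra_simps)
  also have "(\<lambda>t. (- \<i>) * (F (cis t) / (cis t - a) * \<i> * cis t)) = (\<lambda>t. F (cis t) / (1 - a * cnj (cis t)))"
  proof
    fix t
    have "cis t * cnj (cis t) = 1"
      using cis_mult[of t "- t"] by (simp add: cis_cnj)
    then have eq: "cis t - a = cis t * (1 - a * cnj (cis t))"
      by (simp add: algebra_simps)
    show "(- \<i>) * (F (cis t) / (cis t - a) * \<i> * cis t) = F (cis t) / (1 - a * cnj (cis t))"
      unfolding eq using nz[of "cis t"]
      by (simp add: mult.assoc[symmetric]) (simp add: mult.commute mult.left_commute)
  qed
  finally show ?thesis
    using integral_circle_measure[OF cont] by simp
qed

text \<open>
  The Poisson kernel of the disc at the point \<open>r * z\<close>, as a function of \<open>w\<close> on the circle.  Radius and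
  direction are separate arguments since the semigroup law concerns the radii.
\<close>

definition circle_poisson :: "real \<Rightarrow> complex \<Rightarrow> complex \<Rightarrow> real" where
  "circle_poisson r z w = (1 - r\<^sup>2) / (cmod (1 - r * cnj z * w))\<^sup>2"

lemma circle_poisson_commute: "circle_poisson r z w = circle_poisson r w z"
proof -
  have "1 - complex_of_real r * cnj z * w = cnj (1 - complex_of_real r * cnj w * z)"
    by (simp add: mult.commute mult.assoc)
  then show ?thesis
    unfolding circle_poisson_def by (metis complex_mod_cnj)
qed

lemma circle_poisson_nonneg: "\<lbrakk>0 \<le> r; r < 1\<rbrakk> \<Longrightarrow> 0 \<le> circle_poisson r z w"
  by (simp add: circle_poisson_def power_le_one)

lemma circle_poisson_eq_Re:
  assumes "0 \<le> r" "r < 1" "cmod z = 1" "cmod w = 1"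
  shows "circle_poisson r z w = Re (2 / (1 - r * cnj z * w) - 1)"
proof -
  define u where "u = r * cnj z * w"
  have nz: "1 - u \<noteq> 0"
    using one_minus_mult_nonzero[of "r * cnj z" w] assms by (simp add: u_def norm_mult)
  have cu: "(cmod u)\<^sup>2 = r\<^sup>2"
    using assms by (simp add: u_def norm_mult power_mult_distrib)
  have "2 / (1 - u) - 1 = (1 + u) / (1 - u)"
    using nz by (simp add: field_simps)
  also have "\<dots> = (1 + u) * cnj (1 - u) / (cmod (1 - u))\<^sup>2"
    using complex_div_cnj by blast
  also have "Re \<dots> = Re ((1 + u) * cnj (1 - u)) / (cmod (1 - u))\<^sup>2"
    by (simp add: Re_divide_of_real flip: of_real_power)
  also have "Re ((1 + u) * cnj (1 - u)) = 1 - (cmod u)\<^sup>2"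
    unfolding cmod_power2 by (simp add: algebra_simps power2_eq_square)
  finally show ?thesis
    using cu by (simp add: circle_poisson_def u_def)
qed

text \<open>
  The kernel as a sum of a Cauchy kernel and a holomorphic function of \<open>w\<close> that vanishes at \<open>0\<close>; the
  reproducing property for holomorphic functions follows by applying Cauchy's formula to both.
\<close>

lemma circle_poisson_eq_sum:
  assumes "0 \<le> r" "r < 1" "cmod z = 1" "cmod w = 1"
  shows "complex_of_real (circle_poisson r z w) =
           1 / (1 - r * z * cnj w) + (1 / (1 - r * cnj z * w) - 1)"
proof -
  define G where "G = 1 / (1 - r * cnj z * w)"
  have "1 / (1 - r * z * cnj w) = cnj G" by (simp add: G_def)
  moreover have "circle_poisson r z w = Re (2 * G - 1)"
    using circle_poisson_eq_Re[OF assms] by (simp add: G_def)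
  moreover have "complex_of_real (Re (2 * G - 1)) = cnj G + (G - 1)"
    by (simp add: complex_eq_iff)
  ultimately show ?thesis
    unfolding G_def[symmetric] by simp
qed

lemma continuous_on_circle_poisson:
  assumes "0 \<le> r" "r < 1" "cmod z = 1"
  shows "continuous_on (sphere 0 1) (circle_poisson r z)"
  unfolding circle_poisson_def
  using one_minus_mult_nonzero[of "r * cnj z"] assms
  by (intro continuous_intros) (auto simp: norm_mult)

lemma circle_poisson_holomorphic:
  fixes F :: "complex \<Rightarrow> complex"
  assumes F: "F holomorphic_on cball 0 1" and r: "0 \<le> r" "r < 1" and z: "cmod z = 1"
  shows "(LINT w|circle_measure. circle_poisson r z w * F w) = F (r * z)"
proof -
  define G where "G = (\<lambda>w. F w * (1 / (1 - r * cnj z * w) - 1))"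
  have nz: "1 - complex_of_real r * cnj z * w \<noteq> 0" if "cmod w \<le> 1" for w
    using one_minus_mult_nonzero[of "r * cnj z" w] r z that by (simp add: norm_mult)
  have G: "G holomorphic_on cball 0 1"
    unfolding G_def using nz by (intro holomorphic_intros F) auto
  have a: "cmod (r * z) < 1" using r z by (simp add: norm_mult)
  have nz': "1 - complex_of_real r * z * cnj w \<noteq> 0" if "cmod w = 1" for w
    using one_minus_mult_nonzero[of "r * z" "cnj w"] r z that by (simp add: norm_mult)
  have i1: "integrable circle_measure (\<lambda>w. F w / (1 - r * z * cnj w))"
    using nz'
    by (intro integrable_circle_continuous continuous_intros holomorphic_on_imp_continuous_on
        holomorphic_on_subset[OF F]) auto
  have i2: "integrable circle_measure G"
    by (intro integrable_circle_continuous holomorphic_on_imp_continuous_on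
        holomorphic_on_subset[OF G]) auto
  have "(LINT w|circle_measure. circle_poisson r z w * F w) =
        (LINT w|circle_measure. F w / (1 - r * z * cnj w) + G w)"
  proof (rule Bochner_Integration.integral_cong[OF refl])
    fix w assume "w \<in> space circle_measure"
    then show "circle_poisson r z w * F w = F w / (1 - r * z * cnj w) + G w"
      using circle_poisson_eq_sum[OF r z, of w] by (simp add: G_def distrib_right)
  qed
  also have "\<dots> = (LINT w|circle_measure. F w / (1 - r * z * cnj w)) + (LINT w|circle_measure. G w)"
    by (rule Bochner_Integration.integral_add[OF i1 i2])
  also have "(LINT w|circle_measure. F w / (1 - r * z * cnj w)) = F (r * z)"
    using circle_Cauchy_formula[OF F a] .
  also have "(LINT w|circle_measure. G w) = 0"
    using circle_Cauchy_formula[OF G, of 0] by (simp add: G_def)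
  finally show ?thesis by simp
qed

lemma integral_circle_poisson:
  assumes "0 \<le> r" "r < 1" "cmod z = 1"
  shows "(LINT w|circle_measure. circle_poisson r z w) = 1"
proof -
  have "complex_of_real (LINT w|circle_measure. circle_poisson r z w) = 1"
    using circle_poisson_holomorphic[of "\<lambda>_. 1" r z] assms by (simp flip: integral_complex_of_real)
  then show ?thesis by (simp only: of_real_eq_1_iff)
qed

text \<open>
  As a function of \<open>w\<close>, the second kernel is the real part of the holomorphic function
  \<open>2 / (1 - s * cnj v * w) - 1\<close>.  Integration against the first kernel evaluates that function at
  \<open>r * z\<close>, which amounts to replacing \<open>s\<close> by \<open>r * s\<close>.
\<close>

lemma circle_poisson_semigroup:
  assumes r: "0 \<le> r" "r < 1" and s: "0 \<le> s" "s < 1" and z: "cmod z = 1" and v: "cmod v = 1"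
  shows "(LINT w|circle_measure. circle_poisson r z w * circle_poisson s w v) = circle_poisson (r * s) z v"
proof -
  define H where "H = (\<lambda>w. 2 / (1 - s * cnj v * w) - 1)"
  have nz: "1 - complex_of_real s * cnj v * w \<noteq> 0" if "cmod w \<le> 1" for w
    using one_minus_mult_nonzero[of "s * cnj v" w] s v that by (simp add: norm_mult)
  have H: "H holomorphic_on cball 0 1"
    unfolding H_def using nz by (intro holomorphic_intros) auto
  have int: "integrable circle_measure (\<lambda>w. circle_poisson r z w * H w)"
    by (intro integrable_circle_continuous continuous_intros continuous_on_of_real
        continuous_on_circle_poisson r z holomorphic_on_imp_continuous_on holomorphic_on_subset[OF H]) auto
  have rs: "r * s < 1"
    using r s mult_left_le[of s r] by linarith
  have "(LINT w|circle_measure. circle_poisson r z w * circle_poisson s w v)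
      = (LINT w|circle_measure. Re (circle_poisson r z w * H w))"
  proof (rule Bochner_Integration.integral_cong[OF refl])
    fix w assume "w \<in> space circle_measure"
    then show "circle_poisson r z w * circle_poisson s w v = Re (circle_poisson r z w * H w)"
      using circle_poisson_eq_Re[OF s v, of w] by (simp add: H_def circle_poisson_commute[of s w])
  qed
  also have "\<dots> = Re (LINT w|circle_measure. circle_poisson r z w * H w)"
    by (rule integral_Re[OF int])
  also have "\<dots> = Re (H (r * z))"
    by (simp only: circle_poisson_holomorphic[OF H r z])
  also have "\<dots> = circle_poisson (r * s) v z"
    using r s v z rs by (subst circle_poisson_eq_Re) (auto simp: H_def mult_ac)
  finally show ?thesis by (simp only: circle_poisson_commute)
qed

lemma circle_poisson_upper:
  assumes "0 \<le> r" "r < 1" "cmod z = 1" "cmod w = 1"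
  shows "circle_poisson r z w \<le> (1 - r\<^sup>2) / (1 - r)\<^sup>2"
proof -
  have "1 - r \<le> cmod (1 - complex_of_real r * cnj z * w)"
    using norm_triangle_ineq2[of 1 "complex_of_real r * cnj z * w"] assms by (simp add: norm_mult)
  then show ?thesis
    unfolding circle_poisson_def using assms
    by (intro divide_left_mono power_mono mult_pos_pos zero_less_power) (auto simp: power_le_one)
qed

text \<open>
  Put \<open>u = cnj z * w\<close>.  The condition on \<open>\<rho> - s\<close> says that \<open>1 - s\<close> is at most three times \<open>1 - \<rho>\<close>.  As
  \<open>1 - \<rho> \<le> \<bar>1 - \<rho> u\<bar>\<close> on the unit circle, it gives \<open>\<bar>1 - s u\<bar> \<le> 3 \<bar>1 - \<rho> u\<bar>\<close>; squaring
  produces the constant.  The numerators compare in the right direction since \<open>s \<le> \<rho>\<close>.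
\<close>

lemma circle_poisson_harnack:
  fixes s \<rho> :: real
  assumes s: "0 \<le> s" "s \<le> \<rho>" and \<rho>: "\<rho> < 1" and le: "\<rho> - s \<le> 2 * (1 - \<rho>)"
    and "cmod z = 1" "cmod w = 1"
  shows "circle_poisson \<rho> z w \<le> 9 * circle_poisson s z w"
proof -
  define u where "u = cnj z * w"
  have cu: "cmod u = 1" using assms by (simp add: u_def norm_mult)
  have pos: "0 < cmod (1 - \<rho> * u)" "0 < cmod (1 - s * u)"
    using one_minus_mult_nonzero[of \<rho> u] one_minus_mult_nonzero[of s u] s \<rho> cu by auto
  have "1 - \<rho> \<le> cmod (1 - \<rho> * u)"
    using norm_triangle_ineq2[of 1 "\<rho> * u"] cu s \<rho> by (simp add: norm_mult)
  moreover have "cmod (1 - s * u) \<le> cmod (1 - \<rho> * u) + (\<rho> - s)"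
  proof -
    have "1 - s * u = (1 - \<rho> * u) + (\<rho> - s) * u" by (simp add: algebra_simps)
    also have "cmod \<dots> \<le> cmod (1 - \<rho> * u) + cmod ((\<rho> - s) * u)"
      by (rule norm_triangle_ineq)
    also have "cmod ((\<rho> - s) * u) = \<rho> - s"
      using cu s by (simp add: norm_mult flip: of_real_diff)
    finally show ?thesis .
  qed
  ultimately have "cmod (1 - s * u) \<le> 3 * cmod (1 - \<rho> * u)"
    using le by argo
  then have "(cmod (1 - s * u))\<^sup>2 \<le> (3 * cmod (1 - \<rho> * u))\<^sup>2"
    by (intro power_mono) auto
  then have sq: "(cmod (1 - s * u))\<^sup>2 \<le> 9 * (cmod (1 - \<rho> * u))\<^sup>2"
    by (simp add: power_mult_distrib)
  have "(1 - \<rho>\<^sup>2) / (cmod (1 - \<rho> * u))\<^sup>2 \<le> (1 - s\<^sup>2) / (cmod (1 - \<rho> * u))\<^sup>2"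
    using s by (intro divide_right_mono) (auto intro: power_mono)
  also have "\<dots> \<le> (1 - s\<^sup>2) * (9 / (cmod (1 - s * u))\<^sup>2)"
  proof -
    have "1 / (cmod (1 - \<rho> * u))\<^sup>2 \<le> 9 / (cmod (1 - s * u))\<^sup>2"
      using sq pos by (simp add: field_simps)
    moreover have "0 \<le> 1 - s\<^sup>2" using s \<rho> by (simp add: power_le_one)
    ultimately show ?thesis
      by (metis mult_left_mono mult.right_neutral times_divide_eq_right)
  qed
  finally show ?thesis by (simp add: circle_poisson_def u_def mult_ac)
qed

text \<open>
  The kernel concentrates at \<open>z\<close>: since \<open>\<bar>w - z\<bar> \<le> \<bar>1 - r * cnj z * w\<bar> + (1 - r)\<close> and \<open>1 - r\<close> is at
  most \<open>\<bar>1 - r * cnj z * w\<bar>\<close>, the factor \<open>\<bar>w - z\<bar>\<^sup>2\<close> cancels the denominator up to the factor \<open>4\<close>.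
\<close>

lemma circle_poisson_dist_le:
  assumes r: "0 \<le> r" "r < 1" and z: "cmod z = 1" and w: "cmod w = 1"
  shows "(cmod (w - z))\<^sup>2 * circle_poisson r z w \<le> 4 * (1 - r\<^sup>2)"
proof -
  define u where "u = cnj z * w"
  have cu: "cmod u = 1" using z w by (simp add: u_def norm_mult)
  have pos: "0 < cmod (1 - r * u)"
    using one_minus_mult_nonzero[of r u] r cu by auto
  have zz: "z * cnj z = 1" using z by (simp add: complex_norm_square[symmetric])
  have "w - z = z * (u - 1)" using zz by (simp add: u_def algebra_simps)
  then have "cmod (w - z) = cmod (1 - u)" using z by (simp add: norm_mult norm_minus_commute)
  also have "1 - u = (1 - r * u) + (r - 1) * u" by (simp add: algebra_simps)
  also have "cmod \<dots> \<le> cmod (1 - r * u) + cmod ((r - 1) * u)"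
    by (rule norm_triangle_ineq)
  also have "cmod ((r - 1) * u) = 1 - r"
    using cu r norm_of_real[of "r - 1", where 'a = complex] by (simp add: norm_mult)
  also have "1 - r \<le> cmod (1 - r * u)"
    using norm_triangle_ineq2[of 1 "r * u"] cu r by (simp add: norm_mult)
  finally have "(cmod (w - z))\<^sup>2 \<le> (2 * cmod (1 - r * u))\<^sup>2"
    by (intro power_mono) auto
  then have "(cmod (w - z))\<^sup>2 * (1 - r\<^sup>2) \<le> 4 * (cmod (1 - r * u))\<^sup>2 * (1 - r\<^sup>2)"
    using r by (intro mult_right_mono) (auto simp: power_mult_distrib power_le_one)
  then have "(cmod (w - z))\<^sup>2 * (1 - r\<^sup>2) \<le> 4 * (1 - r\<^sup>2) * (cmod (1 - r * u))\<^sup>2"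
    by (simp only: mult_ac)
  then have "(cmod (w - z))\<^sup>2 * (1 - r\<^sup>2) / (cmod (1 - r * u))\<^sup>2 \<le> 4 * (1 - r\<^sup>2)"
    using pos by (subst pos_divide_le_eq) auto
  then show ?thesis
    by (simp add: circle_poisson_def u_def mult.assoc)
qed

section \<open>The Poisson kernel of the polydisc with equal radii\<close>

lemma prob_space_torus_measure: "prob_space (torus_measure :: ('n::finite \<Rightarrow> complex) measure)"
  unfolding torus_measure_def by (intro prob_space_PiM prob_space_circle_measure)

lemma space_torus_measure: "space (torus_measure :: ('n::finite \<Rightarrow> complex) measure) = {z. \<forall>j. cmod (z j) = 1}"
  by (auto simp: torus_measure_def space_PiM PiE_def)

lemma sets_torus_measure [measurable_cong]:
  "sets (torus_measure :: ('n::finite \<Rightarrow> complex) measure) = sets (Pi\<^sub>M UNIV (\<lambda>_. circle_measure))"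
  by (simp add: torus_measure_def)

lemma borel_measurable_torus_component [measurable]:
  "(\<lambda>z. z j) \<in> borel_measurable (torus_measure :: ('n::finite \<Rightarrow> complex) measure)"
  using measurable_compose[OF measurable_component_singleton[of j UNIV "\<lambda>_. circle_measure"] borel_measurable_circle_id]
  by (simp add: torus_measure_def)

lemma product_sigma_finite_circle: "product_sigma_finite (\<lambda>_. circle_measure)"
  unfolding product_sigma_finite_def
  by (auto intro: prob_space_imp_sigma_finite prob_space_circle_measure)

lemma integral_torus_prod:
  fixes f :: "'n::finite \<Rightarrow> complex \<Rightarrow> 'a::{real_normed_field, banach, second_countable_topology}"
  assumes "\<And>j. integrable circle_measure (f j)"
  shows "(LINT z|torus_measure. (\<Prod>j\<in>UNIV. f j (z j))) = (\<Prod>j\<in>UNIV. (LINT w|circle_measure. f j w))"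
proof -
  interpret product_sigma_finite "\<lambda>_::'n. circle_measure"
    by (rule product_sigma_finite_circle)
  show ?thesis
    unfolding torus_measure_def by (intro product_integral_prod assms) auto
qed

definition poisson_kernel :: "real \<Rightarrow> ('n::finite \<Rightarrow> complex) \<Rightarrow> ('n \<Rightarrow> complex) \<Rightarrow> real" where
  "poisson_kernel r z w = (\<Prod>j\<in>UNIV. circle_poisson r (z j) (w j))"

definition poisson_integral ::
    "real \<Rightarrow> (('n::finite \<Rightarrow> complex) \<Rightarrow> real) \<Rightarrow> ('n \<Rightarrow> complex) \<Rightarrow> real" where
  "poisson_integral r u z = (LINT w|torus_measure. poisson_kernel r z w * u w)"

lemma poisson_kernel_nonneg: "\<lbrakk>0 \<le> r; r < 1\<rbrakk> \<Longrightarrow> 0 \<le> poisson_kernel r z w"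
  unfolding poisson_kernel_def by (intro prod_nonneg ballI circle_poisson_nonneg)

lemma poisson_kernel_commute: "poisson_kernel r z w = poisson_kernel r w z"
  unfolding poisson_kernel_def by (intro prod.cong refl circle_poisson_commute)

lemma poisson_kernel_upper:
  fixes z w :: "'n::finite \<Rightarrow> complex"
  assumes "0 \<le> r" "r < 1" "z \<in> space torus_measure" "w \<in> space torus_measure"
  shows "poisson_kernel r z w \<le> ((1 - r\<^sup>2) / (1 - r)\<^sup>2) ^ CARD('n)"
proof -
  have "poisson_kernel r z w \<le> (\<Prod>j\<in>(UNIV::'n set). (1 - r\<^sup>2) / (1 - r)\<^sup>2)"
    unfolding poisson_kernel_def using assms
    by (intro prod_mono conjI circle_poisson_nonneg circle_poisson_upper)
       (auto simp: space_torus_measure)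
  then show ?thesis by simp
qed

lemma borel_measurable_cnj [measurable]: "cnj \<in> borel_measurable borel"
  by (intro borel_measurable_continuous_onI continuous_intros)

lemma borel_measurable_circle_poisson [measurable]:
  assumes [measurable]: "f \<in> borel_measurable N" "g \<in> borel_measurable N"
  shows "(\<lambda>x. circle_poisson r (f x) (g x)) \<in> borel_measurable N"
  unfolding circle_poisson_def by measurable

lemma borel_measurable_poisson_kernel [measurable]:
  assumes [measurable]: "\<And>j. (\<lambda>x. f x j) \<in> borel_measurable N" "\<And>j. (\<lambda>x. g x j) \<in> borel_measurable N"
  shows "(\<lambda>x. poisson_kernel r (f x) (g x)) \<in> borel_measurable N"
  unfolding poisson_kernel_def by measurable

lemma borel_measurable_poisson_kernel_right [measurable]:
  "poisson_kernel r z \<in> borel_measurable torus_measure"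
  by measurable

lemma integral_poisson_kernel:
  assumes "0 \<le> r" "r < 1" "z \<in> space torus_measure"
  shows "(LINT w|torus_measure. poisson_kernel r z w) = 1"
  unfolding poisson_kernel_def using assms
  by (subst integral_torus_prod)
     (auto simp: space_torus_measure integral_circle_poisson
       intro!: integrable_circle_continuous continuous_on_circle_poisson)

lemma poisson_kernel_semigroup:
  assumes "0 \<le> r" "r < 1" "0 \<le> s" "s < 1" "z \<in> space torus_measure" "v \<in> space torus_measure"
  shows "(LINT w|torus_measure. poisson_kernel r z w * poisson_kernel s w v) = poisson_kernel (r * s) z v"
proof -
  have "(LINT w|torus_measure. poisson_kernel r z w * poisson_kernel s w v) =
        (LINT w|torus_measure. (\<Prod>j\<in>UNIV. circle_poisson r (z j) (w j) * circle_poisson s (v j) (w j)))"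
    by (simp add: poisson_kernel_def prod.distrib circle_poisson_commute[of s _ "v _"])
  also have "\<dots> = (\<Prod>j\<in>UNIV. (LINT w|circle_measure. circle_poisson r (z j) w * circle_poisson s (v j) w))"
    using assms
    by (intro integral_torus_prod integrable_circle_continuous continuous_intros continuous_on_circle_poisson)
       (auto simp: space_torus_measure)
  also have "\<dots> = poisson_kernel (r * s) z v"
    unfolding poisson_kernel_def using assms
    by (intro prod.cong refl)
       (simp add: space_torus_measure circle_poisson_semigroup circle_poisson_commute[of s "v _"])
  finally show ?thesis .
qed

lemma integrable_poisson_kernel_mult:
  fixes u :: "('n::finite \<Rightarrow> complex) \<Rightarrow> real"
  assumes r: "0 \<le> r" "r < 1" and z: "z \<in> space torus_measure" and u: "integrable torus_measure u"
  shows "integrable torus_measure (\<lambda>w. poisson_kernel r z w * u w)"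
proof (rule Bochner_Integration.integrable_bound)
  show "integrable torus_measure (\<lambda>w. ((1 - r\<^sup>2) / (1 - r)\<^sup>2) ^ CARD('n) * u w)"
    using u by (rule integrable_mult_right)
  show "(\<lambda>w. poisson_kernel r z w * u w) \<in> borel_measurable torus_measure"
    using u by (intro borel_measurable_times) auto
  show "AE w in torus_measure. norm (poisson_kernel r z w * u w)
        \<le> norm (((1 - r\<^sup>2) / (1 - r)\<^sup>2) ^ CARD('n) * u w)"
  proof (rule AE_I2)
    fix w :: "'n \<Rightarrow> complex" assume w: "w \<in> space torus_measure"
    have "\<bar>poisson_kernel r z w\<bar> \<le> \<bar>((1 - r\<^sup>2) / (1 - r)\<^sup>2) ^ CARD('n)\<bar>"
      using poisson_kernel_upper[OF r z w] poisson_kernel_nonneg[OF r, of z w] by linarith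
    then show "norm (poisson_kernel r z w * u w) \<le> norm (((1 - r\<^sup>2) / (1 - r)\<^sup>2) ^ CARD('n) * u w)"
      unfolding real_norm_def abs_mult by (rule mult_right_mono) simp
  qed
qed

lemma poisson_integral_const:
  assumes "0 \<le> r" "r < 1" "z \<in> space torus_measure"
  shows "poisson_integral r (\<lambda>_. c) z = c"
  using integral_poisson_kernel[OF assms] by (simp add: poisson_integral_def)

lemma poisson_integral_add:
  assumes "0 \<le> r" "r < 1" "z \<in> space torus_measure" "integrable torus_measure u" "integrable torus_measure v"
  shows "poisson_integral r (\<lambda>w. u w + v w) z = poisson_integral r u z + poisson_integral r v z"
  using assms by (simp add: poisson_integral_def distrib_left integrable_poisson_kernel_mult)

lemma poisson_integral_mono:
  assumes "0 \<le> r" "r < 1" "z \<in> space torus_measure" "integrable torus_measure u" "integrable torus_measure v"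
    "\<And>w. w \<in> space torus_measure \<Longrightarrow> u w \<le> v w"
  shows "poisson_integral r u z \<le> poisson_integral r v z"
  unfolding poisson_integral_def using assms
  by (intro integral_mono integrable_poisson_kernel_mult mult_left_mono poisson_kernel_nonneg)

lemma poisson_integral_nonneg:
  assumes "0 \<le> r" "r < 1" "\<And>w. w \<in> space torus_measure \<Longrightarrow> 0 \<le> u w"
  shows "0 \<le> poisson_integral r u z"
  unfolding poisson_integral_def using assms
  by (intro Bochner_Integration.integral_nonneg mult_nonneg_nonneg poisson_kernel_nonneg)

text \<open>
  This integrability on the product of two tori licenses the interchanges of integrals below.
\<close>

lemma integrable_poisson_kernel_product:
  fixes u :: "('n::finite \<Rightarrow> complex) \<Rightarrow> real"
  assumes r: "0 \<le> r" "r < 1" and u: "integrable torus_measure u"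
  shows "integrable (torus_measure \<Otimes>\<^sub>M torus_measure) (\<lambda>(z, w). poisson_kernel r z w * u w)"
proof -
  interpret T: prob_space "torus_measure :: ('n \<Rightarrow> complex) measure" by (rule prob_space_torus_measure)
  interpret pair_sigma_finite "torus_measure :: ('n \<Rightarrow> complex) measure" "torus_measure :: ('n \<Rightarrow> complex) measure" ..
  have [measurable]: "u \<in> borel_measurable torus_measure" using u by simp
  have meas [measurable]: "(\<lambda>(z, w). poisson_kernel r z w * u w) \<in> borel_measurable (torus_measure \<Otimes>\<^sub>M torus_measure)"
    unfolding case_prod_beta by measurable
  show ?thesis
  proof (rule Fubini_integrable[OF meas])
    show "AE z in torus_measure. integrable torus_measure (\<lambda>w. case (z, w) of (z, w) \<Rightarrow> poisson_kernel r z w * u w)"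
      using r u by (auto intro!: AE_I2 integrable_poisson_kernel_mult)
    show "integrable torus_measure (\<lambda>z. (LINT w|torus_measure. norm (case (z, w) of (z, w) \<Rightarrow> poisson_kernel r z w * u w)))"
    proof (rule T.integrable_const_bound)
      show "(\<lambda>z. (LINT w|torus_measure. norm (case (z, w) of (z, w) \<Rightarrow> poisson_kernel r z w * u w))) \<in> borel_measurable torus_measure"
        by measurable
      show "AE z in torus_measure. norm (LINT w|torus_measure. norm (case (z, w) of (z, w) \<Rightarrow> poisson_kernel r z w * u w))
          \<le> (LINT w|torus_measure. ((1 - r\<^sup>2) / (1 - r)\<^sup>2) ^ CARD('n) * norm (u w))"
      proof (rule AE_I2)
        fix z :: "'n \<Rightarrow> complex" assume z: "z \<in> space torus_measure"
        have "(LINT w|torus_measure. norm (case (z, w) of (z, w) \<Rightarrow> poisson_kernel r z w * u w))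
            \<le> (LINT w|torus_measure. ((1 - r\<^sup>2) / (1 - r)\<^sup>2) ^ CARD('n) * norm (u w))"
          using u r z poisson_kernel_upper[OF r z] poisson_kernel_nonneg[OF r, of z]
          by (intro integral_mono integrable_mult_right integrable_norm)
             (auto simp: abs_mult intro!: integrable_poisson_kernel_mult mult_right_mono)
        moreover have "0 \<le> (LINT w|torus_measure. norm (case (z, w) of (z, w) \<Rightarrow> poisson_kernel r z w * u w))"
          by (intro Bochner_Integration.integral_nonneg) auto
        ultimately show "norm (LINT w|torus_measure. norm (case (z, w) of (z, w) \<Rightarrow> poisson_kernel r z w * u w))
          \<le> (LINT w|torus_measure. ((1 - r\<^sup>2) / (1 - r)\<^sup>2) ^ CARD('n) * norm (u w))"
          by simp
      qed
    qed
  qed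
qed

lemma
  fixes u :: "('n::finite \<Rightarrow> complex) \<Rightarrow> real"
  assumes r: "0 \<le> r" "r < 1" and u: "integrable torus_measure u"
  shows integrable_poisson_integral: "integrable torus_measure (poisson_integral r u)"
    and integral_poisson_integral:
      "(LINT z|torus_measure. poisson_integral r u z) = (LINT z|torus_measure. u z)"
proof -
  interpret T: prob_space "torus_measure :: ('n \<Rightarrow> complex) measure" by (rule prob_space_torus_measure)
  interpret pair_sigma_finite "torus_measure :: ('n \<Rightarrow> complex) measure" "torus_measure :: ('n \<Rightarrow> complex) measure" ..
  note int = integrable_poisson_kernel_product[OF r u]
  show "integrable torus_measure (poisson_integral r u)"
    using integrable_fst[OF int] by (simp add: poisson_integral_def[abs_def])
  have "(LINT z|torus_measure. poisson_integral r u z) =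
        (LINT w|torus_measure. (LINT z|torus_measure. poisson_kernel r z w * u w))"
    unfolding poisson_integral_def using Fubini_integral[OF int] by simp
  also have "\<dots> = (LINT w|torus_measure. u w)"
  proof (rule Bochner_Integration.integral_cong[OF refl])
    fix w :: "'n \<Rightarrow> complex" assume "w \<in> space torus_measure"
    then show "(LINT z|torus_measure. poisson_kernel r z w * u w) = u w"
      using integral_poisson_kernel[OF r, of w] by (simp add: poisson_kernel_commute[of r _ w])
  qed
  finally show "(LINT z|torus_measure. poisson_integral r u z) = (LINT z|torus_measure. u z)" .
qed

text \<open>
  This law identifies the powers of the operator \<open>poisson_integral r\<close> with the operators
  \<open>poisson_integral (r ^ k)\<close>, so that ergodic averages are averages of Poisson integrals.
\<close>

lemma poisson_integral_semigroup:
  fixes u :: "('n::finite \<Rightarrow> complex) \<Rightarrow> real"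
  assumes r: "0 \<le> r" "r < 1" and s: "0 \<le> s" "s < 1" and u: "integrable torus_measure u"
    and z: "z \<in> space torus_measure"
  shows "poisson_integral r (poisson_integral s u) z = poisson_integral (r * s) u z"
proof -
  interpret T: prob_space "torus_measure :: ('n \<Rightarrow> complex) measure" by (rule prob_space_torus_measure)
  interpret pair_sigma_finite "torus_measure :: ('n \<Rightarrow> complex) measure" "torus_measure :: ('n \<Rightarrow> complex) measure" ..
  have [measurable]: "u \<in> borel_measurable torus_measure" using u by simp
  have int: "integrable (torus_measure \<Otimes>\<^sub>M torus_measure)
      (\<lambda>(w, v). poisson_kernel r z w * (poisson_kernel s w v * u v))"
  proof (rule Bochner_Integration.integrable_bound)
    show "integrable (torus_measure \<Otimes>\<^sub>M torus_measure)
        (\<lambda>p. ((1 - r\<^sup>2) / (1 - r)\<^sup>2) ^ CARD('n) * (case p of (w, v) \<Rightarrow> poisson_kernel s w v * u v))"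
      by (intro integrable_mult_right integrable_poisson_kernel_product s u)
    show "(\<lambda>(w, v). poisson_kernel r z w * (poisson_kernel s w v * u v))
        \<in> borel_measurable (torus_measure \<Otimes>\<^sub>M torus_measure)"
      unfolding case_prod_beta by measurable
    show "AE p in torus_measure \<Otimes>\<^sub>M torus_measure.
        norm (case p of (w, v) \<Rightarrow> poisson_kernel r z w * (poisson_kernel s w v * u v))
        \<le> norm (((1 - r\<^sup>2) / (1 - r)\<^sup>2) ^ CARD('n) * (case p of (w, v) \<Rightarrow> poisson_kernel s w v * u v))"
      using poisson_kernel_upper[OF r z] poisson_kernel_nonneg[OF r, of z]
      by (intro AE_I2)
         (auto simp: space_pair_measure abs_mult intro!: mult_right_mono order_trans[OF _ abs_ge_self])
  qed
  have "poisson_integral r (poisson_integral s u) z =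
     (LINT w|torus_measure. (LINT v|torus_measure. poisson_kernel r z w * (poisson_kernel s w v * u v)))"
    by (simp add: poisson_integral_def)
  also have "\<dots> = (LINT v|torus_measure. (LINT w|torus_measure. poisson_kernel r z w * (poisson_kernel s w v * u v)))"
    using Fubini_integral[OF int] by simp
  also have "\<dots> = (LINT v|torus_measure. poisson_kernel (r * s) z v * u v)"
  proof (rule Bochner_Integration.integral_cong[OF refl])
    fix v :: "'n \<Rightarrow> complex" assume v: "v \<in> space torus_measure"
    have "(LINT w|torus_measure. poisson_kernel r z w * (poisson_kernel s w v * u v)) =
          (LINT w|torus_measure. (poisson_kernel r z w * poisson_kernel s w v) * u v)"
      by (simp add: mult.assoc)
    also have "\<dots> = poisson_kernel (r * s) z v * u v"
      by (subst integral_mult_left_zero) (simp add: poisson_kernel_semigroup[OF r s z v])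
    finally show "(LINT w|torus_measure. poisson_kernel r z w * (poisson_kernel s w v * u v)) =
        poisson_kernel (r * s) z v * u v" .
  qed
  finally show ?thesis by (simp add: poisson_integral_def)
qed

section \<open>The maximal ergodic theorem\<close>

text \<open>
  Hopf's maximal ergodic theorem with Garsia's proof.  For additive \<open>T\<close>, \<open>S k\<close> is the sum of
  \<open>h\<close> and its first \<open>k - 1\<close> iterates under \<open>T\<close>.  The recursion for \<open>R\<close> dominates \<open>S 0, \<dots>, S k\<close> by \<open>R k\<close>, and
  \<open>R N \<le> h + T (R N)\<close> wherever \<open>R N > 0\<close>.  Let \<open>E\<close> be the set where \<open>R N > 0\<close>.  Integration over
  \<open>E\<close> gives \<open>\<integral>\<^sub>E h \<ge> \<integral> R N - \<integral> T (R N)\<close>, which is nonnegative because \<open>T\<close> does not increase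
  the integrals of nonnegative functions.
\<close>

lemma maximal_ergodic_theorem:
  fixes T :: "('a \<Rightarrow> real) \<Rightarrow> 'a \<Rightarrow> real"
  assumes integrable_T: "\<And>f. integrable M f \<Longrightarrow> integrable M (T f)"
    and mono_T: "\<And>f g x. \<lbrakk>integrable M f; integrable M g; \<And>y. y \<in> space M \<Longrightarrow> f y \<le> g y; x \<in> space M\<rbrakk>
                   \<Longrightarrow> T f x \<le> T g x"
    and contraction_T: "\<And>f. \<lbrakk>integrable M f; \<And>y. y \<in> space M \<Longrightarrow> 0 \<le> f y\<rbrakk>
                   \<Longrightarrow> (LINT x|M. T f x) \<le> (LINT x|M. f x)"
    and T_nonneg: "\<And>f x. \<lbrakk>integrable M f; \<And>y. y \<in> space M \<Longrightarrow> 0 \<le> f y; x \<in> space M\<rbrakk> \<Longrightarrow> 0 \<le> T f x"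
    and h: "integrable M h"
  defines "S \<equiv> \<lambda>k. ((\<lambda>f x. h x + T f x) ^^ k) (\<lambda>_. 0)"
  obtains E where "E \<in> sets M" "\<And>k x. \<lbrakk>k \<le> N; x \<in> space M; 0 < S k x\<rbrakk> \<Longrightarrow> x \<in> E"
    "0 \<le> (LINT x|M. indicator E x * h x)"
proof -
  define R where "R = (\<lambda>k. ((\<lambda>f x. max 0 (h x + T f x)) ^^ k) (\<lambda>_. 0))"
  have R_0: "R 0 = (\<lambda>_. 0)" and R_Suc: "R (Suc k) x = max 0 (h x + T (R k) x)" for k x
    by (simp_all add: R_def)
  have S_0: "S 0 = (\<lambda>_. 0)" and S_Suc: "S (Suc k) x = h x + T (S k) x" for k x
    by (simp_all add: S_def)
  have R_int: "integrable M (R k)" for k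
  proof (induction k)
    case (Suc k)
    have "integrable M (\<lambda>x. max 0 (h x + T (R k) x))"
      by (intro integrable_max Bochner_Integration.integrable_add integrable_T h Suc) auto
    then show ?case by (simp add: R_Suc[abs_def])
  qed (simp add: R_0)
  have S_int: "integrable M (S k)" for k
  proof (induction k)
    case (Suc k)
    have "integrable M (\<lambda>x. h x + T (S k) x)"
      by (intro Bochner_Integration.integrable_add integrable_T h Suc)
    then show ?case by (simp add: S_Suc[abs_def])
  qed (simp add: S_0)
  have R_nonneg: "0 \<le> R k x" for k x
    by (cases k) (simp_all add: R_0 R_Suc)
  have R_mono: "R k x \<le> R (Suc k) x" if "x \<in> space M" for k x
    using that
  proof (induction k arbitrary: x)
    case (Suc k)
    have "T (R k) x \<le> T (R (Suc k)) x"
      by (intro mono_T R_int Suc)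
    then show ?case by (auto simp: R_Suc[of k] R_Suc[of "Suc k"])
  qed (simp add: R_0 R_nonneg)
  have R_mono': "R k x \<le> R N x" if "k \<le> N" "x \<in> space M" for k x
    using that by (induction N rule: dec_induct) (auto intro: order_trans R_mono)
  have S_le_R: "S k x \<le> R k x" if "x \<in> space M" for k x
    using that
  proof (induction k arbitrary: x)
    case (Suc k)
    have "T (S k) x \<le> T (R k) x"
      by (intro mono_T R_int S_int Suc)
    then show ?case by (simp add: R_Suc S_Suc)
  qed (simp add: R_0 S_0)
  define E where "E = {x \<in> space M. 0 < R N x}"
  have [measurable]: "R N \<in> borel_measurable M" "h \<in> borel_measurable M"
    using R_int h by auto
  have E: "E \<in> sets M" unfolding E_def by measurable
  have h_int: "integrable M (\<lambda>x. indicator E x * h x)"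
    using integrable_real_mult_indicator[OF E h] by (simp add: mult.commute)
  have "R N x - T (R N) x \<le> indicator E x * h x" if x: "x \<in> space M" for x
  proof (cases "x \<in> E")
    case True
    then obtain k where k: "N = Suc k"
      by (cases N) (auto simp: E_def R_0)
    have "R N x = h x + T (R k) x"
      using True by (auto simp: E_def k R_Suc max_def split: if_splits)
    also have "T (R k) x \<le> T (R N) x"
      by (intro mono_T R_int x) (simp add: k R_mono)
    finally show ?thesis using True by simp
  next
    case False
    then show ?thesis
      using x R_nonneg[of N x] T_nonneg[OF R_int R_nonneg x, of N] by (auto simp: E_def)
  qed
  then have "(LINT x|M. R N x - T (R N) x) \<le> (LINT x|M. indicator E x * h x)"
    by (intro integral_mono h_int Bochner_Integration.integrable_diff integrable_T R_int)
  moreover have "(LINT x|M. R N x - T (R N) x) = (LINT x|M. R N x) - (LINT x|M. T (R N) x)"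
    by (intro Bochner_Integration.integral_diff integrable_T R_int)
  ultimately have "0 \<le> (LINT x|M. indicator E x * h x)"
    using contraction_T[OF R_int R_nonneg, of N] by linarith
  moreover have "x \<in> E" if "k \<le> N" "x \<in> space M" "0 < S k x" for k x
    using that S_le_R[of x k] R_mono'[of k x] by (auto simp: E_def)
  ultimately show ?thesis using E that by blast
qed

section \<open>The radial maximal function of Poisson integrals\<close>

lemma poisson_integral_cong:
  "(\<And>w. w \<in> space torus_measure \<Longrightarrow> u w = v w) \<Longrightarrow> poisson_integral r u z = poisson_integral r v z"
  unfolding poisson_integral_def by (intro Bochner_Integration.integral_cong) auto

text \<open>
  The maximal ergodic theorem for \<open>T = poisson_integral r\<close> and \<open>h = u - l\<close>.  Since \<open>T\<close> preserves
  constants, \<open>S (k + 1)\<close> is the sum of \<open>u\<close> and its Poisson integrals of radii \<open>r, \<dots>, r ^ k\<close>, minus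
  \<open>(k + 1) * l\<close>.
\<close>

lemma poisson_maximal_averages:
  fixes u :: "('n::finite \<Rightarrow> complex) \<Rightarrow> real"
  assumes r: "0 \<le> r" "r < 1" and u: "integrable torus_measure u"
    and u_nonneg: "\<And>w. w \<in> space torus_measure \<Longrightarrow> 0 \<le> u w"
  obtains E where "E \<in> sets torus_measure"
    "l * measure torus_measure E \<le> (LINT w|torus_measure. u w)"
    "\<And>k z. \<lbrakk>k < N; z \<in> space torus_measure - E\<rbrakk>
       \<Longrightarrow> u z + (\<Sum>i=1..k. poisson_integral (r ^ i) u z) \<le> (k + 1) * l"
proof -
  interpret T: prob_space "torus_measure :: ('n \<Rightarrow> complex) measure" by (rule prob_space_torus_measure)
  define h where "h = (\<lambda>w. u w - l)"
  define S where "S = (\<lambda>k. ((\<lambda>f x. h x + poisson_integral r f x) ^^ k) (\<lambda>_. 0))"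
  define Q where "Q = (\<lambda>k z. u z + (\<Sum>i=1..k. poisson_integral (r ^ i) u z))"
  have S_Suc: "S (Suc k) x = h x + poisson_integral r (S k) x" for k x
    by (simp add: S_def)
  have h: "integrable torus_measure h"
    unfolding h_def using u by simp
  have pow: "0 \<le> r ^ i" "0 < i \<Longrightarrow> r ^ i < 1" for i
    using r by (auto simp: power_less_one_iff)
  have Q_int: "integrable torus_measure (Q k)" for k
    unfolding Q_def using pow
    by (intro Bochner_Integration.integrable_add Bochner_Integration.integrable_sum u integrable_poisson_integral) auto
  have TQ: "poisson_integral r (Q k) z = (\<Sum>i=1..Suc k. poisson_integral (r ^ i) u z)"
    if z: "z \<in> space torus_measure" for k z
  proof (induction k)
    case 0
    then show ?case by (simp add: Q_def)
  next
    case (Suc k)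
    have "poisson_integral r (Q (Suc k)) z = poisson_integral r (\<lambda>w. Q k w + poisson_integral (r ^ Suc k) u w) z"
      by (simp add: Q_def add.assoc)
    also have "\<dots> = poisson_integral r (Q k) z + poisson_integral r (poisson_integral (r ^ Suc k) u) z"
      by (intro poisson_integral_add r z Q_int integrable_poisson_integral pow u) simp
    also have "poisson_integral r (poisson_integral (r ^ Suc k) u) z = poisson_integral (r ^ Suc (Suc k)) u z"
      using poisson_integral_semigroup[OF r pow(1) pow(2) u z, of "Suc k"] by simp
    finally show ?case by (simp only: Suc.IH) simp
  qed
  have S_eq: "S (Suc k) z = Q k z - (k + 1) * l" if "z \<in> space torus_measure" for k z
    using that
  proof (induction k arbitrary: z)
    case 0
    then show ?case by (simp add: S_Suc) (simp add: S_def Q_def h_def poisson_integral_def)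
  next
    case (Suc k)
    have "S (Suc (Suc k)) z = h z + poisson_integral r (S (Suc k)) z"
      by (rule S_Suc)
    also have "poisson_integral r (S (Suc k)) z = poisson_integral r (\<lambda>w. Q k w + - ((k + 1) * l)) z"
      using Suc.IH by (intro poisson_integral_cong) simp
    also have "\<dots> = poisson_integral r (Q k) z + poisson_integral r (\<lambda>_. - ((k + 1) * l)) z"
      by (intro poisson_integral_add r Suc.prems Q_int) simp
    also have "\<dots> = (\<Sum>i=1..Suc k. poisson_integral (r ^ i) u z) - (k + 1) * l"
      by (simp only: TQ[OF Suc.prems] poisson_integral_const[OF r Suc.prems])
    finally show ?case by (simp add: h_def Q_def algebra_simps)
  qed
  obtain E where E: "E \<in> sets torus_measure"
    and in_E: "\<And>k x. \<lbrakk>k \<le> N; x \<in> space torus_measure; 0 < S k x\<rbrakk> \<Longrightarrow> x \<in> E"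
    and pos: "0 \<le> (LINT x|torus_measure. indicator E x * h x)"
  proof (rule maximal_ergodic_theorem[of torus_measure "poisson_integral r" h N])
    show "integrable torus_measure (poisson_integral r f)" if "integrable torus_measure f" for f
      by (rule integrable_poisson_integral[OF r that])
    show "(LINT x|torus_measure. poisson_integral r f x) \<le> (LINT x|torus_measure. f x)"
      if "integrable torus_measure f" for f :: "('n \<Rightarrow> complex) \<Rightarrow> real"
      using integral_poisson_integral[OF r that] by simp
  qed (use r h in \<open>auto simp: S_def intro: poisson_integral_mono poisson_integral_nonneg\<close>)
  have iE: "integrable torus_measure (\<lambda>w. indicator E w * u w)"
    using integrable_real_mult_indicator[OF E u] by (simp add: mult.commute)
  have "(LINT x|torus_measure. indicator E x * h x) = (LINT x|torus_measure. indicator E x * u x - l * indicator E x)"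
    by (simp add: h_def algebra_simps)
  also have "\<dots> = (LINT x|torus_measure. indicator E x * u x) - l * measure torus_measure E"
    using E iE by (subst Bochner_Integration.integral_diff) (auto simp: less_top[symmetric] sets.Int_space_eq2)
  also have "(LINT x|torus_measure. indicator E x * u x) \<le> (LINT x|torus_measure. u x)"
    using u_nonneg by (intro integral_mono iE u) (auto simp: indicator_def)
  finally have "l * measure torus_measure E \<le> (LINT w|torus_measure. u w)"
    using pos by linarith
  moreover have "u z + (\<Sum>i=1..k. poisson_integral (r ^ i) u z) \<le> (k + 1) * l"
    if "k < N" "z \<in> space torus_measure - E" for k z
  proof -
    have "\<not> 0 < S (Suc k) z" using in_E[of "Suc k" z] that by auto
    then show ?thesis using S_eq[of z k] that by (simp add: Q_def)
  qed
  ultimately show ?thesis using that E by blast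
qed

lemma poisson_kernel_harnack:
  fixes z w :: "'n::finite \<Rightarrow> complex"
  assumes "0 \<le> s" "s \<le> \<rho>" "\<rho> < 1" "\<rho> - s \<le> 2 * (1 - \<rho>)"
    and "z \<in> space torus_measure" "w \<in> space torus_measure"
  shows "poisson_kernel \<rho> z w \<le> 9 ^ CARD('n) * poisson_kernel s z w"
proof -
  have "poisson_kernel \<rho> z w \<le> (\<Prod>j\<in>UNIV. 9 * circle_poisson s (z j) (w j))"
    unfolding poisson_kernel_def using assms
    by (intro prod_mono conjI circle_poisson_nonneg circle_poisson_harnack) (auto simp: space_torus_measure)
  then show ?thesis by (simp add: prod.distrib poisson_kernel_def)
qed

lemma poisson_integral_harnack:
  fixes u :: "('n::finite \<Rightarrow> complex) \<Rightarrow> real"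
  assumes s: "0 \<le> s" "s \<le> \<rho>" and \<rho>: "\<rho> < 1" and le: "\<rho> - s \<le> 2 * (1 - \<rho>)"
    and z: "z \<in> space torus_measure" and u: "integrable torus_measure u"
    and u_nonneg: "\<And>w. w \<in> space torus_measure \<Longrightarrow> 0 \<le> u w"
  shows "poisson_integral \<rho> u z \<le> 9 ^ CARD('n) * poisson_integral s u z"
proof -
  have "poisson_integral \<rho> u z \<le> (LINT w|torus_measure. 9 ^ CARD('n) * (poisson_kernel s z w * u w))"
    unfolding poisson_integral_def
  proof (intro integral_mono integrable_mult_right integrable_poisson_kernel_mult z u)
    fix w :: "'n \<Rightarrow> complex" assume w: "w \<in> space torus_measure"
    show "poisson_kernel \<rho> z w * u w \<le> 9 ^ CARD('n) * (poisson_kernel s z w * u w)"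
      using mult_right_mono[OF poisson_kernel_harnack[OF s \<rho> le z w] u_nonneg[OF w]]
      by (simp add: mult.assoc)
  qed (use s \<rho> in auto)
  then show ?thesis by (simp add: poisson_integral_def)
qed

text \<open>
  Let \<open>N\<close> be the least exponent with \<open>r ^ N \<le> \<rho>\<close>.  All powers \<open>r ^ i\<close> with \<open>N \<le> i < 2 * N\<close> lie
  between \<open>\<rho> ^ 3\<close> and \<open>\<rho>\<close>, hence are close enough to \<open>\<rho>\<close> for the Harnack inequality.  So the
  Poisson integral of radius \<open>\<rho>\<close> is at most \<open>9 ^ CARD('n)\<close> times their average over these \<open>N\<close> exponents,
  which is at most twice the ergodic average over the first \<open>2 * N\<close> terms.  The lower bound \<open>1/2\<close> on
  \<open>\<rho>\<close> keeps \<open>N\<close> bounded, so that a maximal inequality for finitely many averages suffices.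
\<close>

lemma poisson_maximal_weak_type_upto:
  fixes u :: "('n::finite \<Rightarrow> complex) \<Rightarrow> real"
  assumes r: "r < 1" and u: "integrable torus_measure u"
    and u_nonneg: "\<And>w. w \<in> space torus_measure \<Longrightarrow> 0 \<le> u w"
  obtains E where "E \<in> sets torus_measure"
    "l * measure torus_measure E \<le> (LINT w|torus_measure. u w)"
    "\<And>\<rho> z. \<lbrakk>1/2 \<le> \<rho>; \<rho> \<le> r; z \<in> space torus_measure - E\<rbrakk>
       \<Longrightarrow> poisson_integral \<rho> u z \<le> 2 * 9 ^ CARD('n) * l"
proof -
  \<comment> \<open>Powers of the radius need a nonnegative base; for \<open>r < 1/2\<close> no \<open>\<rho>\<close> is admissible.\<close>
  define r' where "r' = max r 0"
  have r': "0 \<le> r'" "r' < 1" using r by (auto simp: r'_def)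
  obtain N0 where N0: "r' ^ N0 < 1/2"
    using real_arch_pow_inv[of "1/2" r'] r' by auto
  obtain E where E: "E \<in> sets torus_measure"
    and mE: "l * measure torus_measure E \<le> (LINT w|torus_measure. u w)"
    and av: "\<And>k z. \<lbrakk>k < 2 * N0; z \<in> space torus_measure - E\<rbrakk>
       \<Longrightarrow> u z + (\<Sum>i=1..k. poisson_integral (r' ^ i) u z) \<le> (k + 1) * l"
    using poisson_maximal_averages[OF r' u u_nonneg, of l "2 * N0"] by auto
  have "poisson_integral \<rho> u z \<le> 2 * 9 ^ CARD('n) * l"
    if \<rho>: "1/2 \<le> \<rho>" "\<rho> \<le> r" and z: "z \<in> space torus_measure - E" for \<rho> z
  proof -
    have \<rho>': "0 < \<rho>" "\<rho> \<le> r'" "\<rho> < 1" using \<rho> r by (auto simp: r'_def)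
    define N where "N = (LEAST m. r' ^ m \<le> \<rho>)"
    have ex: "r' ^ N0 \<le> \<rho>" using N0 \<rho> by simp
    have N_le: "r' ^ N \<le> \<rho>" and "N \<le> N0"
      unfolding N_def using ex by (rule LeastI, rule Least_le)
    have "N \<noteq> 0"
    proof
      assume "N = 0"
      then show False using N_le \<rho>' by simp
    qed
    then obtain m where m: "N = Suc m" by (cases N) auto
    have m_gt: "\<rho> < r' ^ m"
      using not_less_Least[of m "\<lambda>m. r' ^ m \<le> \<rho>"] m by (simp add: N_def[symmetric])
    have le: "poisson_integral \<rho> u z \<le> 9 ^ CARD('n) * poisson_integral (r' ^ i) u z"
      if i: "i \<in> {N..2 * m + 1}" for i
    proof (rule poisson_integral_harnack)
      show "r' ^ i \<le> \<rho>"
        using i r' N_le power_decreasing[of N i r'] by auto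
      \<comment> \<open>Minimality of \<open>N = m + 1\<close> means \<open>\<rho> < r' ^ m\<close>, and the largest exponent is \<open>2 * m + 1\<close>.\<close>
      have "\<rho> * (\<rho> * \<rho>) \<le> r' * (r' ^ m * r' ^ m)"
        using \<rho>' m_gt r' by (intro mult_mono) auto
      also have "\<dots> = r' ^ (2 * m + 1)"
        by (simp add: mult_2 power_add)
      also have "\<dots> \<le> r' ^ i"
        using i r' by (intro power_decreasing) auto
      finally have "\<rho> - r' ^ i \<le> \<rho> - \<rho> * (\<rho> * \<rho>)" by simp
      also have "\<dots> = (\<rho> * (1 + \<rho>)) * (1 - \<rho>)"
        by (simp add: algebra_simps)
      also have "\<dots> \<le> 2 * (1 - \<rho>)"
      proof (rule mult_right_mono)
        have "\<rho> * (1 + \<rho>) \<le> 1 * 2" using \<rho>' by (intro mult_mono) auto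
        then show "\<rho> * (1 + \<rho>) \<le> 2" by simp
      qed (use \<rho>' in simp)
      finally show "\<rho> - r' ^ i \<le> 2 * (1 - \<rho>)" .
    qed (use \<rho>' r' z u u_nonneg in auto)
    have "N * poisson_integral \<rho> u z = (\<Sum>i\<in>{N..2 * m + 1}. poisson_integral \<rho> u z)"
      using m by simp
    also have "\<dots> \<le> (\<Sum>i\<in>{N..2 * m + 1}. 9 ^ CARD('n) * poisson_integral (r' ^ i) u z)"
      by (intro sum_mono le)
    also have "\<dots> = 9 ^ CARD('n) * (\<Sum>i\<in>{N..2 * m + 1}. poisson_integral (r' ^ i) u z)"
      by (rule sum_distrib_left[symmetric])
    also have "\<dots> \<le> 9 ^ CARD('n) * (u z + (\<Sum>i=1..2 * m + 1. poisson_integral (r' ^ i) u z))"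
    proof (intro mult_left_mono)
      have "(\<Sum>i\<in>{N..2 * m + 1}. poisson_integral (r' ^ i) u z) \<le> (\<Sum>i=1..2 * m + 1. poisson_integral (r' ^ i) u z)"
        using r' u_nonneg m by (intro sum_mono2 poisson_integral_nonneg) (auto simp: power_less_one_iff)
      then show "(\<Sum>i\<in>{N..2 * m + 1}. poisson_integral (r' ^ i) u z)
          \<le> u z + (\<Sum>i=1..2 * m + 1. poisson_integral (r' ^ i) u z)"
        using u_nonneg[of z] z by simp
    qed simp
    also have "\<dots> \<le> 9 ^ CARD('n) * (real (2 * m + 1 + 1) * l)"
      using av[of "2 * m + 1" z] z m \<open>N \<le> N0\<close> by (intro mult_left_mono) auto
    also have "\<dots> = N * (2 * 9 ^ CARD('n) * l)"
      using m by simp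
    finally show ?thesis
      using m by (simp add: mult_le_cancel_left)
  qed
  then show ?thesis using that E mE by blast
qed

text \<open>
  The bound for radii up to \<open>r\<close> does not depend on \<open>r\<close>, but the exceptional sets \<open>E k\<close> obtained for
  \<open>r = 1 - 1 / (k + 1)\<close> need not be nested.  Their lower limit still works: a point outside it lies
  outside \<open>E k\<close> for arbitrarily large \<open>k\<close>, and the measure of a lower limit is at most the uniform
  bound.  An exceptional set also avoids the question whether the maximal function is measurable.
\<close>

lemma poisson_maximal_weak_type:
  fixes u :: "('n::finite \<Rightarrow> complex) \<Rightarrow> real"
  assumes u: "integrable torus_measure u"
    and u_nonneg: "\<And>w. w \<in> space torus_measure \<Longrightarrow> 0 \<le> u w" and l: "0 < l"
  obtains E where "E \<in> sets torus_measure"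
    "measure torus_measure E \<le> 2 * 9 ^ CARD('n) * (LINT w|torus_measure. u w) / l"
    "\<And>\<rho> z. \<lbrakk>1/2 \<le> \<rho>; \<rho> < 1; z \<in> space torus_measure - E\<rbrakk> \<Longrightarrow> poisson_integral \<rho> u z \<le> l"
proof -
  interpret T: prob_space "torus_measure :: ('n \<Rightarrow> complex) measure" by (rule prob_space_torus_measure)
  define C where "C = 2 * 9 ^ CARD('n) * (LINT w|torus_measure. u w) / l"
  define r :: "nat \<Rightarrow> real" where "r = (\<lambda>k. 1 - 1 / (Suc k))"
  have "\<exists>E. E \<in> sets torus_measure \<and> measure torus_measure E \<le> C \<and>
     (\<forall>\<rho> z. 1/2 \<le> \<rho> \<longrightarrow> \<rho> \<le> r k \<longrightarrow> z \<in> space torus_measure - E \<longrightarrow> poisson_integral \<rho> u z \<le> l)" for k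
  proof -
    have "r k < 1" by (simp add: r_def)
    from poisson_maximal_weak_type_upto[OF this u u_nonneg, of "l / (2 * 9 ^ CARD('n))"]
    obtain E where "E \<in> sets torus_measure"
      "l / (2 * 9 ^ CARD('n)) * measure torus_measure E \<le> (LINT w|torus_measure. u w)"
      "\<And>\<rho> z. \<lbrakk>1/2 \<le> \<rho>; \<rho> \<le> r k; z \<in> space torus_measure - E\<rbrakk>
         \<Longrightarrow> poisson_integral \<rho> u z \<le> 2 * 9 ^ CARD('n) * (l / (2 * 9 ^ CARD('n)))"
      by blast
    then show ?thesis
      using l by (intro exI[of _ E]) (auto simp: C_def field_simps)
  qed
  then obtain E where E: "\<And>k. E k \<in> sets torus_measure" "\<And>k. measure torus_measure (E k) \<le> C"
    "\<And>k \<rho> z. \<lbrakk>1/2 \<le> \<rho>; \<rho> \<le> r k; z \<in> space torus_measure - E k\<rbrakk> \<Longrightarrow> poisson_integral \<rho> u z \<le> l"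
    by metis
  define A where "A = (\<lambda>m. \<Inter>k\<in>{m..}. E k)"
  have A: "A m \<in> sets torus_measure" for m
    unfolding A_def using E(1) by (intro sets.countable_INT) auto
  have "incseq A"
    unfolding A_def by (intro monoI INT_anti_mono) auto
  then have "(\<lambda>m. measure torus_measure (A m)) \<longlonglongrightarrow> measure torus_measure (\<Union>m. A m)"
    using A by (intro T.finite_Lim_measure_incseq) auto
  moreover have "measure torus_measure (A m) \<le> C" for m
  proof -
    have "measure torus_measure (A m) \<le> measure torus_measure (E m)"
      using E(1) by (intro T.finite_measure_mono) (auto simp: A_def)
    then show ?thesis using E(2)[of m] by linarith
  qed
  ultimately have "measure torus_measure (\<Union>m. A m) \<le> C"
    by (intro LIMSEQ_le_const2) auto
  moreover have "poisson_integral \<rho> u z \<le> l"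
    if "1/2 \<le> \<rho>" "\<rho> < 1" "z \<in> space torus_measure - (\<Union>m. A m)" for \<rho> z
  proof -
    have "0 < 1 - \<rho>" using that by simp
    then obtain m where m: "1 / real (Suc m) < 1 - \<rho>"
      by (rule nat_approx_posE)
    have "z \<notin> A m" using that by blast
    then obtain k where k: "m \<le> k" "z \<notin> E k" by (auto simp: A_def)
    have "1 / real (Suc k) \<le> 1 / real (Suc m)"
      using k by (intro divide_left_mono) auto
    then have "\<rho> \<le> r k" using m by (simp add: r_def)
    then show ?thesis using E(3) k that by blast
  qed
  moreover have "(\<Union>m. A m) \<in> sets torus_measure" using A by blast
  ultimately show ?thesis using that unfolding C_def by blast
qed

section \<open>Completeness and projections in the space of square integrable functions\<close>

definition square_integrable :: "'a measure \<Rightarrow> ('a \<Rightarrow> complex) set" where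
  "square_integrable M = {f \<in> borel_measurable M. integrable M (\<lambda>x. (cmod (f x))\<^sup>2)}"

definition sqnorm :: "'a measure \<Rightarrow> ('a \<Rightarrow> complex) \<Rightarrow> real" where
  "sqnorm M f = (LINT x|M. (cmod (f x))\<^sup>2)"

definition inner_prod :: "'a measure \<Rightarrow> ('a \<Rightarrow> complex) \<Rightarrow> ('a \<Rightarrow> complex) \<Rightarrow> complex" where
  "inner_prod M f g = (LINT x|M. f x * cnj (g x))"

lemma sqnorm_nonneg: "0 \<le> sqnorm M f"
  unfolding sqnorm_def by (intro Bochner_Integration.integral_nonneg) auto

lemma square_integrable_measurable: "f \<in> square_integrable M \<Longrightarrow> f \<in> borel_measurable M"
  by (simp add: square_integrable_def)

lemma square_integrable_cmult:
  "f \<in> square_integrable M \<Longrightarrow> (\<lambda>x. c * f x) \<in> square_integrable M"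
  unfolding square_integrable_def by (auto simp: norm_mult power_mult_distrib)

lemma sqnorm_cmult: "sqnorm M (\<lambda>x. c * f x) = (cmod c)\<^sup>2 * sqnorm M f"
  by (simp add: sqnorm_def norm_mult power_mult_distrib)

lemma square_integrable_add:
  assumes f: "f \<in> square_integrable M" and g: "g \<in> square_integrable M"
  shows "(\<lambda>x. f x + g x) \<in> square_integrable M"
proof -
  have [measurable]: "f \<in> borel_measurable M" "g \<in> borel_measurable M"
    using f g by (auto simp: square_integrable_def)
  have "integrable M (\<lambda>x. (cmod (f x + g x))\<^sup>2)"
  proof (rule Bochner_Integration.integrable_bound)
    show "integrable M (\<lambda>x. 2 * (cmod (f x))\<^sup>2 + 2 * (cmod (g x))\<^sup>2)"
      using f g by (simp add: square_integrable_def)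
    show "AE x in M. norm ((cmod (f x + g x))\<^sup>2) \<le> norm (2 * (cmod (f x))\<^sup>2 + 2 * (cmod (g x))\<^sup>2)"
    proof (rule AE_I2)
      fix x
      have "(cmod (f x + g x))\<^sup>2 \<le> (cmod (f x) + cmod (g x))\<^sup>2"
        by (intro power_mono norm_triangle_ineq) auto
      also have "\<dots> \<le> 2 * (cmod (f x))\<^sup>2 + 2 * (cmod (g x))\<^sup>2"
        using sum_squares_bound[of "cmod (f x)" "cmod (g x)"] by (simp add: power2_sum)
      finally show "norm ((cmod (f x + g x))\<^sup>2) \<le> norm (2 * (cmod (f x))\<^sup>2 + 2 * (cmod (g x))\<^sup>2)"
        by simp
    qed
  qed measurable
  then show ?thesis by (simp add: square_integrable_def)
qed

lemma square_integrable_diff: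
  assumes "f \<in> square_integrable M" and "g \<in> square_integrable M"
  shows "(\<lambda>x. f x - g x) \<in> square_integrable M"
  using square_integrable_add[OF assms(1) square_integrable_cmult[OF assms(2), of "-1"]] by simp

lemma square_integrable_sqnorm: "f \<in> square_integrable M \<Longrightarrow> integrable M (\<lambda>x. (cmod (f x))\<^sup>2)"
  by (simp add: square_integrable_def)

lemma integrable_inner:
  assumes f: "f \<in> square_integrable M" and g: "g \<in> square_integrable M"
  shows "integrable M (\<lambda>x. f x * cnj (g x))"
proof (rule Bochner_Integration.integrable_bound)
  show "integrable M (\<lambda>x. (cmod (f x))\<^sup>2 + (cmod (g x))\<^sup>2)"
    using f g by (simp add: square_integrable_def)
  show "(\<lambda>x. f x * cnj (g x)) \<in> borel_measurable M"
    using f g square_integrable_measurable[of _ M] by measurable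
  show "AE x in M. norm (f x * cnj (g x)) \<le> norm ((cmod (f x))\<^sup>2 + (cmod (g x))\<^sup>2)"
  proof (rule AE_I2)
    fix x
    have "2 * (cmod (f x) * cmod (g x)) \<le> (cmod (f x))\<^sup>2 + (cmod (g x))\<^sup>2"
      using sum_squares_bound[of "cmod (f x)" "cmod (g x)"] by simp
    moreover have "0 \<le> cmod (f x) * cmod (g x)" by simp
    ultimately have "cmod (f x) * cmod (g x) \<le> (cmod (f x))\<^sup>2 + (cmod (g x))\<^sup>2" by linarith
    then show "norm (f x * cnj (g x)) \<le> norm ((cmod (f x))\<^sup>2 + (cmod (g x))\<^sup>2)"
      by (simp add: norm_mult)
  qed
qed

lemma inner_prod_add_left:
  assumes "f \<in> square_integrable M" "g \<in> square_integrable M" "v \<in> square_integrable M"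
  shows "inner_prod M (\<lambda>x. f x + g x) v = inner_prod M f v + inner_prod M g v"
  unfolding inner_prod_def using assms by (simp add: distrib_right integrable_inner)

lemma inner_prod_diff_left:
  assumes "f \<in> square_integrable M" "g \<in> square_integrable M" "v \<in> square_integrable M"
  shows "inner_prod M (\<lambda>x. f x - g x) v = inner_prod M f v - inner_prod M g v"
  unfolding inner_prod_def using assms by (simp add: left_diff_distrib integrable_inner)

lemma inner_prod_cmult_left: "inner_prod M (\<lambda>x. c * f x) v = c * inner_prod M f v"
  unfolding inner_prod_def by (simp add: mult.assoc)

lemma inner_prod_cnj: "inner_prod M g f = cnj (inner_prod M f g)"
  unfolding inner_prod_def by (simp add: mult.commute flip: Bochner_Integration.integral_cnj)

lemma inner_prod_add_right:
  assumes "f \<in> square_integrable M" "g \<in> square_integrable M" "v \<in> square_integrable M"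
  shows "inner_prod M v (\<lambda>x. f x + g x) = inner_prod M v f + inner_prod M v g"
  by (subst (1 2 3) inner_prod_cnj) (simp add: inner_prod_add_left assms)

lemma inner_prod_cmult_right: "inner_prod M v (\<lambda>x. c * f x) = cnj c * inner_prod M v f"
  by (subst (1 2) inner_prod_cnj) (simp add: inner_prod_cmult_left)

lemma inner_prod_self: "inner_prod M f f = of_real (sqnorm M f)"
  unfolding inner_prod_def sqnorm_def integral_complex_of_real[symmetric]
  by (simp add: complex_norm_square del: of_real_power)

lemma sqnorm_diff_cmult:
  assumes f: "f \<in> square_integrable M" and g: "g \<in> square_integrable M"
  shows "sqnorm M (\<lambda>x. f x - t * g x) =
           sqnorm M f - 2 * Re (cnj t * inner_prod M f g) + (cmod t)\<^sup>2 * sqnorm M g"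
proof -
  note tg = square_integrable_cmult[OF g, of "- t"]
  note fg = square_integrable_add[OF f tg]
  have "of_real (sqnorm M (\<lambda>x. f x - t * g x)) = inner_prod M (\<lambda>x. f x + - t * g x) (\<lambda>x. f x + - t * g x)"
    by (simp add: inner_prod_self)
  also have "\<dots> = of_real (sqnorm M f) - cnj t * inner_prod M f g - t * cnj (inner_prod M f g)
      + (t * cnj t) * of_real (sqnorm M g)"
    by (subst inner_prod_add_left[OF f tg fg], subst inner_prod_add_right[OF f tg f],
        subst inner_prod_add_right[OF f tg tg])
       (simp only: inner_prod_cmult_left inner_prod_cmult_right,
        simp add: inner_prod_self inner_prod_cnj[of M g f] mult.assoc)
  also have "Re \<dots> = sqnorm M f - 2 * Re (cnj t * inner_prod M f g) + (cmod t)\<^sup>2 * sqnorm M g"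
    by (simp add: complex_norm_square[symmetric] del: of_real_power)
  finally show ?thesis by simp
qed

text \<open>
  Pythagoras for the subtraction of the component of \<open>f\<close> along \<open>g\<close>; the Cauchy-Schwarz inequality
  and the orthogonality of a nearest point both come from this identity.
\<close>

lemma sqnorm_minus_component:
  assumes f: "f \<in> square_integrable M" and g: "g \<in> square_integrable M" and nz: "sqnorm M g \<noteq> 0"
  shows "sqnorm M (\<lambda>x. f x - inner_prod M f g / of_real (sqnorm M g) * g x) =
           sqnorm M f - (cmod (inner_prod M f g))\<^sup>2 / sqnorm M g"
proof -
  define I where "I = inner_prod M f g"
  define G where "G = sqnorm M g"
  have G: "G \<noteq> 0" using nz by (simp add: G_def)
  have "cnj (I / of_real G) * I = of_real ((cmod I)\<^sup>2 / G)"
    by (simp add: complex_norm_square mult.commute del: of_real_power)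
  then have 1: "Re (cnj (I / of_real G) * I) = (cmod I)\<^sup>2 / G"
    by (metis Re_complex_of_real)
  have 2: "(cmod (I / of_real G))\<^sup>2 * G = (cmod I)\<^sup>2 / G"
    using G by (simp add: norm_divide power_divide power2_eq_square)
  show ?thesis
    unfolding sqnorm_diff_cmult[OF f g] I_def[symmetric] G_def[symmetric] 1 2 by simp
qed

lemma inner_prod_cauchy_schwarz:
  assumes f: "f \<in> square_integrable M" and g: "g \<in> square_integrable M"
  shows "(cmod (inner_prod M f g))\<^sup>2 \<le> sqnorm M f * sqnorm M g"
proof (cases "sqnorm M g = 0")
  case True
  have "AE x in M. (cmod (g x))\<^sup>2 = 0"
    using True integral_nonneg_eq_0_iff_AE[OF square_integrable_sqnorm[OF g]] by (simp add: sqnorm_def)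
  then have "inner_prod M f g = (LINT x|M. 0)"
    unfolding inner_prod_def using integrable_inner[OF f g]
    by (intro integral_cong_AE) auto
  then show ?thesis by (simp add: True)
next
  case False
  then have "0 < sqnorm M g" using sqnorm_nonneg[of M g] by linarith
  moreover have "0 \<le> sqnorm M f - (cmod (inner_prod M f g))\<^sup>2 / sqnorm M g"
    using sqnorm_nonneg sqnorm_minus_component[OF f g False] by metis
  ultimately show ?thesis by (simp add: field_simps)
qed

lemma inner_prod_le_sqrt:
  assumes "f \<in> square_integrable M" and "g \<in> square_integrable M"
  shows "cmod (inner_prod M f g) \<le> sqrt (sqnorm M f) * sqrt (sqnorm M g)"
  using inner_prod_cauchy_schwarz[OF assms] by (metis norm_ge_zero real_le_rsqrt real_sqrt_mult)

lemma sqnorm_parallelogram: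
  assumes f: "f \<in> square_integrable M" and g: "g \<in> square_integrable M"
  shows "sqnorm M (\<lambda>x. f x - g x) + sqnorm M (\<lambda>x. f x + g x) = 2 * sqnorm M f + 2 * sqnorm M g"
  using sqnorm_diff_cmult[OF f g, of 1] sqnorm_diff_cmult[OF f g, of "-1"] by simp

text \<open>
  Riesz-Fischer for sequences that are Cauchy at a geometric rate.  The increments
  \<open>d n = u (n + 1) - u n\<close> have integrals of size \<open>2 ^ (- n)\<close>, so that they are absolutely summable almost
  everywhere, and the norm estimate passes to the pointwise limit by Fatou's lemma.
\<close>

lemma (in finite_measure) square_integrable_complete:
  assumes u: "\<And>n. u n \<in> square_integrable M"
    and cauchy: "\<And>m n. m \<le> n \<Longrightarrow> sqnorm M (\<lambda>x. u n x - u m x) \<le> c * (1/4) ^ m"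
  obtains h where "h \<in> square_integrable M" "\<And>m. sqnorm M (\<lambda>x. h x - u m x) \<le> c * (1/4) ^ m"
proof -
  have c: "0 \<le> c" using cauchy[of 0 0] sqnorm_nonneg[of M] by (metis le_refl mult.right_neutral order_trans power_0)
  have [measurable]: "u n \<in> borel_measurable M" for n
    by (rule square_integrable_measurable[OF u])
  define d where "d = (\<lambda>n x. u (Suc n) x - u n x)"
  have [measurable]: "d n \<in> borel_measurable M" for n
    unfolding d_def by measurable
  have d_sq: "integrable M (\<lambda>x. (cmod (d n x))\<^sup>2)" for n
    unfolding d_def by (intro square_integrable_sqnorm square_integrable_diff u)
  \<comment> \<open>From \<open>t \<le> a + t\<^sup>2 / a\<close> with \<open>a = 2 ^ (- n)\<close>, valid whether \<open>t \<le> a\<close> or not.\<close>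
  have d_le: "(\<integral>\<^sup>+x. ennreal (cmod (d n x)) \<partial>M) \<le> ennreal ((measure M (space M) + c) * (1/2) ^ n)" for n
  proof -
    have "(\<integral>\<^sup>+x. ennreal (cmod (d n x)) \<partial>M) \<le> (\<integral>\<^sup>+x. ennreal ((1/2) ^ n + 2 ^ n * (cmod (d n x))\<^sup>2) \<partial>M)"
    proof (intro nn_integral_mono ennreal_leI)
      fix x
      define t where "t = cmod (d n x)"
      show "t \<le> (1/2) ^ n + 2 ^ n * t\<^sup>2"
      proof (cases "t \<le> (1/2) ^ n")
        case False
        then have "1 \<le> 2 ^ n * t" by (simp add: field_simps)
        then have "t * 1 \<le> t * (2 ^ n * t)" by (intro mult_left_mono) (auto simp: t_def)
        then have "t \<le> 2 ^ n * t\<^sup>2" by (simp add: power2_eq_square mult_ac)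
        also have "\<dots> \<le> (1/2) ^ n + 2 ^ n * t\<^sup>2" by simp
        finally show ?thesis .
      qed (simp add: add_increasing2)
    qed
    also have "\<dots> = ennreal (LINT x|M. (1/2) ^ n + 2 ^ n * (cmod (d n x))\<^sup>2)"
      using d_sq by (intro nn_integral_eq_integral) auto
    also have "(LINT x|M. (1/2) ^ n + 2 ^ n * (cmod (d n x))\<^sup>2) = (1/2) ^ n * measure M (space M) + 2 ^ n * sqnorm M (d n)"
      using d_sq by (subst Bochner_Integration.integral_add) (auto simp: sqnorm_def)
    also have "\<dots> \<le> (1/2) ^ n * measure M (space M) + 2 ^ n * (c * (1/4) ^ n)"
      using cauchy[of n "Suc n"] by (simp add: d_def)
    also have "2 ^ n * (c * (1/4) ^ n) = c * (1/2) ^ n"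
      by (simp add: power_mult_distrib[symmetric] mult.left_commute[of _ c])
    finally show ?thesis by (simp add: algebra_simps ennreal_leI)
  qed
  have "(\<integral>\<^sup>+x. (\<Sum>n. ennreal (cmod (d n x))) \<partial>M) = (\<Sum>n. \<integral>\<^sup>+x. ennreal (cmod (d n x)) \<partial>M)"
    by (intro nn_integral_suminf) measurable
  also have "\<dots> \<le> (\<Sum>n. ennreal ((measure M (space M) + c) * (1/2) ^ n))"
    by (intro suminf_le d_le) auto
  also have "\<dots> < \<infinity>"
    using c by (subst suminf_ennreal2) (auto intro!: summable_mult summable_geometric)
  finally have "AE x in M. (\<Sum>n. ennreal (cmod (d n x))) \<noteq> \<infinity>"
    by (intro nn_integral_PInf_AE) auto
  then have conv: "AE x in M. convergent (\<lambda>n. u n x)"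
  proof (rule AE_mp, intro AE_I2 impI)
    fix x assume "(\<Sum>n. ennreal (cmod (d n x))) \<noteq> \<infinity>"
    then have "summable (\<lambda>n. cmod (d n x))"
      by (intro summable_suminf_not_top) auto
    then have "summable (\<lambda>n. d n x)" by (rule summable_norm_cancel)
    then have "convergent (\<lambda>n. u 0 x + (\<Sum>k<n. d k x))"
      by (intro convergent_add convergent_const) (simp add: summable_iff_convergent)
    also have "(\<lambda>n. u 0 x + (\<Sum>k<n. d k x)) = (\<lambda>n. u n x)"
      by (simp add: d_def sum_lessThan_telescope[of "\<lambda>n. u n x"])
    finally show "convergent (\<lambda>n. u n x)" .
  qed
  define h where "h = (\<lambda>x. lim (\<lambda>n. u n x))"
  have [measurable]: "h \<in> borel_measurable M" unfolding h_def by measurable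
  have bound: "(\<integral>\<^sup>+x. ennreal ((cmod (h x - u m x))\<^sup>2) \<partial>M) \<le> ennreal (c * (1/4) ^ m)" for m
  proof -
    have "(\<integral>\<^sup>+x. ennreal ((cmod (h x - u m x))\<^sup>2) \<partial>M) =
          (\<integral>\<^sup>+x. liminf (\<lambda>n. ennreal ((cmod (u n x - u m x))\<^sup>2)) \<partial>M)"
    proof (rule nn_integral_cong_AE)
      show "AE x in M. ennreal ((cmod (h x - u m x))\<^sup>2) = liminf (\<lambda>n. ennreal ((cmod (u n x - u m x))\<^sup>2))"
        using conv
      proof (rule AE_mp, intro AE_I2 impI)
        fix x assume "convergent (\<lambda>n. u n x)"
        then have "(\<lambda>n. u n x) \<longlonglongrightarrow> h x" by (simp add: h_def convergent_LIMSEQ_iff)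
        then have "(\<lambda>n. ennreal ((cmod (u n x - u m x))\<^sup>2)) \<longlonglongrightarrow> ennreal ((cmod (h x - u m x))\<^sup>2)"
          by (intro tendsto_ennrealI tendsto_intros)
        then show "ennreal ((cmod (h x - u m x))\<^sup>2) = liminf (\<lambda>n. ennreal ((cmod (u n x - u m x))\<^sup>2))"
          by (metis lim_imp_Liminf sequentially_bot)
      qed
    qed
    also have "\<dots> \<le> liminf (\<lambda>n. \<integral>\<^sup>+x. ennreal ((cmod (u n x - u m x))\<^sup>2) \<partial>M)"
      by (intro nn_integral_liminf) measurable
    also have "\<dots> \<le> ennreal (c * (1/4) ^ m)"
    proof (rule Liminf_le)
      show "\<forall>\<^sub>F n in sequentially. (\<integral>\<^sup>+x. ennreal ((cmod (u n x - u m x))\<^sup>2) \<partial>M) \<le> ennreal (c * (1/4) ^ m)"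
        using eventually_ge_at_top[of m]
      proof eventually_elim
        case (elim n)
        have "(\<integral>\<^sup>+x. ennreal ((cmod (u n x - u m x))\<^sup>2) \<partial>M) = ennreal (sqnorm M (\<lambda>x. u n x - u m x))"
          unfolding sqnorm_def
          by (intro nn_integral_eq_integral square_integrable_sqnorm square_integrable_diff u) auto
        then show ?case using cauchy[OF elim] by (simp add: ennreal_leI)
      qed
    qed simp
    finally show ?thesis .
  qed
  have diff: "(\<lambda>x. h x - u m x) \<in> square_integrable M" for m
  proof -
    have "integrable M (\<lambda>x. (cmod (h x - u m x))\<^sup>2)"
      using le_less_trans[OF bound[of m] ennreal_less_top]
      by (intro integrableI_bounded) auto
    then show ?thesis by (simp add: square_integrable_def)
  qed
  have "h \<in> square_integrable M"
    using square_integrable_add[OF diff[of 0] u[of 0]] by simp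
  moreover have "sqnorm M (\<lambda>x. h x - u m x) \<le> c * (1/4) ^ m" for m
  proof -
    have "ennreal (sqnorm M (\<lambda>x. h x - u m x)) \<le> ennreal (c * (1/4) ^ m)"
      unfolding sqnorm_def
      using bound[of m] nn_integral_eq_integral[OF square_integrable_sqnorm[OF diff[of m]]] by simp
    then show ?thesis using c by (simp add: ennreal_le_iff)
  qed
  ultimately show ?thesis using that by blast
qed

text \<open>
  The nearest point in \<open>S\<close>: by the parallelogram law a minimising sequence is Cauchy.  Orthogonality
  is obtained along the sequence, since \<open>F - u n\<close> is almost minimal and therefore almost orthogonal to
  each \<open>v\<close>, and then in the limit.
\<close>

lemma (in finite_measure) square_integrable_projection:
  assumes S: "S \<subseteq> square_integrable M" "S \<noteq> {}"
    and lin: "\<And>f g a. \<lbrakk>f \<in> S; g \<in> S\<rbrakk> \<Longrightarrow> (\<lambda>x. f x + a * g x) \<in> S"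
    and closed: "\<And>u h. \<lbrakk>\<And>n::nat. u n \<in> S; h \<in> square_integrable M;
                   (\<lambda>n. sqnorm M (\<lambda>x. h x - u n x)) \<longlonglongrightarrow> 0\<rbrakk> \<Longrightarrow> h \<in> S"
    and F: "F \<in> square_integrable M"
  obtains h where "h \<in> S" "\<And>v. v \<in> S \<Longrightarrow> inner_prod M (\<lambda>x. F x - h x) v = 0"
proof -
  define d where "d = Inf ((\<lambda>u. sqnorm M (\<lambda>x. F x - u x)) ` S)"
  have bdd: "bdd_below ((\<lambda>u. sqnorm M (\<lambda>x. F x - u x)) ` S)"
    by (intro bdd_belowI2[of _ 0] sqnorm_nonneg)
  have d_le: "d \<le> sqnorm M (\<lambda>x. F x - u x)" if "u \<in> S" for u
    unfolding d_def by (intro cInf_lower bdd imageI that)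
  have "\<exists>u\<in>S. sqnorm M (\<lambda>x. F x - u x) < d + (1/4) ^ n" for n
    using cInf_lessD[of "(\<lambda>u. sqnorm M (\<lambda>x. F x - u x)) ` S" "d + (1/4) ^ n"] S by (auto simp: d_def)
  then obtain u where u: "\<And>n. u n \<in> S" "\<And>n. sqnorm M (\<lambda>x. F x - u n x) < d + (1/4) ^ n"
    by metis
  have SI: "v \<in> S \<Longrightarrow> v \<in> square_integrable M" for v using S by auto
  have Fu: "(\<lambda>x. F x - v x) \<in> square_integrable M" if "v \<in> S" for v
    by (intro square_integrable_diff F SI that)
  have "sqnorm M (\<lambda>x. u n x - u m x) \<le> 4 * (1/4) ^ m" if mn: "m \<le> n" for m n
  proof -
    \<comment> \<open>The midpoint of \<open>u n\<close> and \<open>u m\<close>, written so that the closure property of \<open>S\<close> applies.\<close>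
    define mid where "mid = (\<lambda>x. u n x + (- (1/2)) * (u n x + (-1) * u m x))"
    have "d \<le> sqnorm M (\<lambda>x. F x - mid x)"
      unfolding mid_def by (intro d_le lin u)
    moreover have "sqnorm M (\<lambda>x. (F x - u m x) + (F x - u n x)) = 4 * sqnorm M (\<lambda>x. F x - mid x)"
    proof -
      have "(\<lambda>x. (F x - u m x) + (F x - u n x)) = (\<lambda>x. 2 * (F x - mid x))"
        by (auto simp: mid_def field_simps)
      then show ?thesis by (simp only: sqnorm_cmult) simp
    qed
    moreover have "sqnorm M (\<lambda>x. (F x - u m x) - (F x - u n x)) + sqnorm M (\<lambda>x. (F x - u m x) + (F x - u n x))
        = 2 * sqnorm M (\<lambda>x. F x - u m x) + 2 * sqnorm M (\<lambda>x. F x - u n x)"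
      by (intro sqnorm_parallelogram Fu u)
    moreover have "sqnorm M (\<lambda>x. (F x - u m x) - (F x - u n x)) = sqnorm M (\<lambda>x. u n x - u m x)"
      by simp
    moreover have "(1/4) ^ n \<le> ((1/4) ^ m :: real)"
      using mn by (intro power_decreasing) auto
    ultimately show ?thesis using u(2)[of m] u(2)[of n] by linarith
  qed
  then obtain h where h: "h \<in> square_integrable M" and hu: "\<And>m. sqnorm M (\<lambda>x. h x - u m x) \<le> 4 * (1/4) ^ m"
    using square_integrable_complete[of u 4] SI u(1) by blast
  have "(\<lambda>n. sqnorm M (\<lambda>x. h x - u n x)) \<longlonglongrightarrow> 0"
  proof (rule tendsto_sandwich[OF _ _ tendsto_const])
    show "\<forall>\<^sub>F n in sequentially. 0 \<le> sqnorm M (\<lambda>x. h x - u n x)"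
      by (simp add: sqnorm_nonneg)
    show "\<forall>\<^sub>F n in sequentially. sqnorm M (\<lambda>x. h x - u n x) \<le> 4 * (1/4) ^ n"
      by (simp add: hu)
    show "(\<lambda>n. 4 * (1/4) ^ n :: real) \<longlonglongrightarrow> 0"
      by (intro tendsto_mult_right_zero LIMSEQ_power_zero) simp
  qed
  then have hS: "h \<in> S" using closed[of u h] u(1) h by blast
  moreover have "inner_prod M (\<lambda>x. F x - h x) v = 0" if v: "v \<in> S" for v
  proof -
    have le: "(cmod (inner_prod M (\<lambda>x. F x - u n x) v))\<^sup>2 \<le> (1/4) ^ n * sqnorm M v" for n
    proof (cases "sqnorm M v = 0")
      case True
      then show ?thesis using inner_prod_cauchy_schwarz[OF Fu[OF u(1)[of n]] SI[OF v]] by simp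
    next
      case False
      define t where "t = inner_prod M (\<lambda>x. F x - u n x) v / of_real (sqnorm M v)"
      have "d \<le> sqnorm M (\<lambda>x. F x - (u n x + t * v x))"
        by (intro d_le lin u v)
      also have "\<dots> = sqnorm M (\<lambda>x. (F x - u n x) - t * v x)"
        by (simp add: diff_diff_eq)
      also have "\<dots> = sqnorm M (\<lambda>x. F x - u n x) - (cmod (inner_prod M (\<lambda>x. F x - u n x) v))\<^sup>2 / sqnorm M v"
        unfolding t_def by (rule sqnorm_minus_component[OF Fu[OF u(1)] SI[OF v] False])
      finally have "(cmod (inner_prod M (\<lambda>x. F x - u n x) v))\<^sup>2 / sqnorm M v \<le> (1/4) ^ n"
        using u(2)[of n] by simp
      moreover have "0 < sqnorm M v" using False sqnorm_nonneg[of M v] by linarith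
      ultimately show ?thesis by (simp add: field_simps)
    qed
    have sq: "sqrt ((1/4) ^ n) = (1/2 :: real) ^ n" for n
      by (simp add: real_sqrt_power real_sqrt_divide)
    have le1: "cmod (inner_prod M (\<lambda>x. F x - u n x) v) \<le> (1/2) ^ n * sqrt (sqnorm M v)" for n
      using real_le_rsqrt[OF le[of n]] by (simp add: real_sqrt_mult sq)
    have le2: "cmod (inner_prod M (\<lambda>x. h x - u n x) v) \<le> 2 * (1/2) ^ n * sqrt (sqnorm M v)" for n
    proof -
      have "sqrt (sqnorm M (\<lambda>x. h x - u n x)) \<le> 2 * (1/2) ^ n"
        using real_sqrt_le_mono[OF hu[of n]] by (simp add: real_sqrt_mult sq)
      then show ?thesis
        using inner_prod_le_sqrt[OF square_integrable_diff[OF h SI[OF u(1)[of n]]] SI[OF v]]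
        by (meson order_trans mult_right_mono real_sqrt_ge_zero sqnorm_nonneg)
    qed
    have "cmod (inner_prod M (\<lambda>x. F x - h x) v) \<le> 3 * (1/2) ^ n * sqrt (sqnorm M v)" for n
    proof -
      have "inner_prod M (\<lambda>x. F x - h x) v = inner_prod M (\<lambda>x. (F x - u n x) - (h x - u n x)) v"
        by simp
      also have "\<dots> = inner_prod M (\<lambda>x. F x - u n x) v - inner_prod M (\<lambda>x. h x - u n x) v"
        by (intro inner_prod_diff_left Fu u square_integrable_diff h SI v)
      also have "cmod \<dots> \<le> cmod (inner_prod M (\<lambda>x. F x - u n x) v) + cmod (inner_prod M (\<lambda>x. h x - u n x) v)"
        by (rule norm_triangle_ineq4)
      finally show ?thesis using le1[of n] le2[of n] by (simp add: algebra_simps)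
    qed
    moreover have "(\<lambda>n. 3 * (1/2) ^ n * sqrt (sqnorm M v)) \<longlonglongrightarrow> 0"
      by (intro tendsto_mult_left_zero tendsto_mult_right_zero LIMSEQ_power_zero) simp
    ultimately have "cmod (inner_prod M (\<lambda>x. F x - h x) v) \<le> 0"
      by (intro LIMSEQ_le_const) auto
    then show ?thesis by simp
  qed
  ultimately show ?thesis using that by blast
qed

section \<open>Lebesgue points with respect to the Poisson kernel\<close>

lemma L2_torus_eq: "L2_torus = square_integrable torus_measure"
  by (simp add: L2_torus_def square_integrable_def)

lemma L2_inner_eq: "L2_inner f g = inner_prod torus_measure f g"
  by (simp add: L2_inner_def inner_prod_def)

lemma monom_e_norm:
  fixes k :: "'n::finite \<Rightarrow> int"
  assumes "z \<in> space torus_measure"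
  shows "cmod (monom_e k z) = 1"
  using assms by (simp add: monom_e_def space_torus_measure prod_norm[symmetric] norm_power_int)

lemma monom_e_L2:
  fixes k :: "'n::finite \<Rightarrow> int"
  shows "monom_e k \<in> L2_torus"
proof -
  interpret prob_space "torus_measure :: ('n \<Rightarrow> complex) measure" by (rule prob_space_torus_measure)
  have [measurable]: "monom_e k \<in> borel_measurable torus_measure"
    unfolding monom_e_def[abs_def] power_int_def by measurable
  show ?thesis
    unfolding L2_torus_def
    by (auto intro!: integrable_const_bound[where B = 1] AE_I2 simp: monom_e_norm)
qed

lemma sqnorm_monom_e:
  fixes k :: "'n::finite \<Rightarrow> int"
  shows "sqnorm torus_measure (monom_e k) = 1"
proof -
  interpret prob_space "torus_measure :: ('n \<Rightarrow> complex) measure" by (rule prob_space_torus_measure)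
  have "sqnorm torus_measure (monom_e k) = (LINT z|(torus_measure :: ('n \<Rightarrow> complex) measure). 1)"
    unfolding sqnorm_def by (intro Bochner_Integration.integral_cong) (auto simp: monom_e_norm)
  then show ?thesis by (simp add: prob_space)
qed

lemma monom_span_square_integrable:
  assumes "p \<in> monom_span K"
  shows "p \<in> square_integrable torus_measure"
proof -
  obtain S c where S: "finite S" and p: "p = (\<lambda>z. \<Sum>k\<in>S. c k * monom_e k z)"
    using assms by (auto simp: monom_span_def)
  have "(\<lambda>z. \<Sum>k\<in>S. c k * monom_e k z) \<in> square_integrable torus_measure"
    using S
  proof induction
    case empty
    then show ?case by (simp add: square_integrable_def)
  next
    case (insert k S)
    have "(\<lambda>z. c k * monom_e k z + (\<Sum>k\<in>S. c k * monom_e k z)) \<in> square_integrable torus_measure"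
      using monom_e_L2 insert.IH
      by (intro square_integrable_add square_integrable_cmult) (auto simp: L2_torus_eq)
    then show ?case using insert.hyps by simp
  qed
  then show ?thesis by (simp add: p)
qed

text \<open>
  The integral factors over the coordinates, and the factors other than the \<open>j\<close>-th are equal to \<open>1\<close>.
\<close>

lemma poisson_integral_coordinate_distance:
  fixes z :: "'n::finite \<Rightarrow> complex"
  assumes r: "0 \<le> r" "r < 1" and z: "z \<in> space torus_measure"
  shows "poisson_integral r (\<lambda>w. (cmod (w j - z j))\<^sup>2) z \<le> 4 * (1 - r\<^sup>2)"
    and "integrable torus_measure (\<lambda>w. (cmod (w j - z j))\<^sup>2)"
proof -
  interpret T: prob_space "torus_measure :: ('n \<Rightarrow> complex) measure" by (rule prob_space_torus_measure)
  interpret C: prob_space circle_measure by (rule prob_space_circle_measure)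
  have z1: "cmod (z i) = 1" for i using z by (simp add: space_torus_measure)
  define F where "F = (\<lambda>i w. circle_poisson r (z i) w * (if i = j then (cmod (w - z i))\<^sup>2 else 1))"
  have F_int: "integrable circle_measure (F i)" for i
  proof (cases "i = j")
    case True
    have "integrable circle_measure (\<lambda>w. circle_poisson r (z j) w * (cmod (w - z j))\<^sup>2)"
      by (intro integrable_circle_continuous continuous_intros continuous_on_circle_poisson r z1)
    then show ?thesis using True by (simp add: F_def)
  next
    case False
    have "integrable circle_measure (\<lambda>w. circle_poisson r (z i) w)"
      by (intro integrable_circle_continuous continuous_on_circle_poisson r z1)
    then show ?thesis using False by (simp add: F_def)
  qed
  have "poisson_integral r (\<lambda>w. (cmod (w j - z j))\<^sup>2) z = (LINT w|torus_measure. (\<Prod>i\<in>UNIV. F i (w i)))"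
    unfolding poisson_integral_def poisson_kernel_def F_def by (simp add: prod.distrib)
  also have "\<dots> = (\<Prod>i\<in>UNIV. (LINT w|circle_measure. F i w))"
    by (rule integral_torus_prod[OF F_int])
  also have "\<dots> = (\<Prod>i\<in>UNIV. if i = j then (LINT w|circle_measure. F j w) else 1)"
    by (intro prod.cong) (auto simp: F_def integral_circle_poisson[OF r z1])
  also have "\<dots> = (LINT w|circle_measure. F j w)"
    by simp
  also have "\<dots> \<le> (LINT w|circle_measure. 4 * (1 - r\<^sup>2))"
    using circle_poisson_dist_le[OF r z1[of j]]
    by (intro integral_mono F_int) (auto simp: F_def mult.commute)
  finally show "poisson_integral r (\<lambda>w. (cmod (w j - z j))\<^sup>2) z \<le> 4 * (1 - r\<^sup>2)"
    by (simp add: C.prob_space[simplified])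
  have "(cmod (w j - z j))\<^sup>2 \<le> 4" if "w \<in> space torus_measure" for w
  proof -
    have "cmod (w j - z j) \<le> 2"
      using norm_triangle_ineq4[of "w j" "z j"] that z by (simp add: space_torus_measure)
    then have "(cmod (w j - z j))\<^sup>2 \<le> 2\<^sup>2" by (intro power_mono) auto
    then show ?thesis by simp
  qed
  then show "integrable torus_measure (\<lambda>w. (cmod (w j - z j))\<^sup>2)"
    by (intro T.integrable_const_bound[where B = 4] AE_I2) auto
qed

lemma power_int_unit_diff:
  fixes z w :: complex
  assumes z: "cmod z = 1" and w: "cmod w = 1"
  shows "cmod (z powi k - w powi k) \<le> \<bar>of_int k\<bar> * cmod (z - w)"
proof (cases "0 \<le> k")
  case True
  then show ?thesis using norm_power_diff[of z w "nat k"] z w by (simp add: power_int_def)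
next
  case False
  have inv: "inverse v = cnj v" if "cmod v = 1" for v
  proof (rule inverse_unique)
    show "v * cnj v = 1" using that by (simp add: complex_norm_square[symmetric])
  qed
  have "cmod (z powi k - w powi k) = cmod (cnj z ^ nat (- k) - cnj w ^ nat (- k))"
    using False by (simp add: power_int_def inv[OF z] inv[OF w])
  also have "\<dots> \<le> nat (- k) * cmod (cnj z - cnj w)"
    using z w by (intro norm_power_diff) auto
  also have "cmod (cnj z - cnj w) = cmod (z - w)"
    by (metis complex_cnj_diff complex_mod_cnj)
  finally show ?thesis using False by simp
qed

lemma monom_span_lipschitz:
  assumes "p \<in> monom_span K"
  obtains B where "0 \<le> B"
    "\<And>z w. \<lbrakk>z \<in> space torus_measure; w \<in> space torus_measure\<rbrakk>
       \<Longrightarrow> (cmod (p w - p z))\<^sup>2 \<le> B * (\<Sum>j\<in>UNIV. (cmod (w j - z j))\<^sup>2)"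
proof -
  obtain S c where S: "finite S" and p: "p = (\<lambda>z. \<Sum>k\<in>S. c k * monom_e k z)"
    using assms by (auto simp: monom_span_def)
  define L where "L = (\<Sum>k\<in>S. cmod (c k) * (\<Sum>j\<in>UNIV. \<bar>of_int (k j)\<bar>))"
  have L: "0 \<le> L" unfolding L_def by (intro sum_nonneg mult_nonneg_nonneg) auto
  have "(cmod (p w - p z))\<^sup>2 \<le> (L\<^sup>2 * CARD('a)) * (\<Sum>j\<in>UNIV. (cmod (w j - z j))\<^sup>2)"
    if z: "z \<in> space torus_measure" and w: "w \<in> space torus_measure" for z w
  proof -
    define D where "D = (\<Sum>j\<in>UNIV. cmod (w j - z j))"
    have D: "cmod (w j - z j) \<le> D" for j
      unfolding D_def by (rule member_le_sum) auto
    have unit: "cmod (z j) = 1" "cmod (w j) = 1" for j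
      using z w by (auto simp: space_torus_measure)
    have "cmod (monom_e k w - monom_e k z) \<le> (\<Sum>j\<in>UNIV. \<bar>of_int (k j)\<bar>) * D" for k
    proof -
      have "cmod (monom_e k w - monom_e k z) \<le> (\<Sum>j\<in>UNIV. cmod (w j powi k j - z j powi k j))"
        unfolding monom_e_def by (intro norm_prod_diff) (auto simp: norm_power_int unit)
      also have "\<dots> \<le> (\<Sum>j\<in>UNIV. \<bar>of_int (k j)\<bar> * D)"
        by (intro sum_mono order_trans[OF power_int_unit_diff] unit mult_left_mono D) auto
      finally show ?thesis by (simp add: sum_distrib_right)
    qed
    then have "(\<Sum>k\<in>S. cmod (c k) * cmod (monom_e k w - monom_e k z)) \<le> (\<Sum>k\<in>S. cmod (c k) * ((\<Sum>j\<in>UNIV. \<bar>of_int (k j)\<bar>) * D))"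
      by (intro sum_mono mult_left_mono) auto
    moreover have "cmod (p w - p z) \<le> (\<Sum>k\<in>S. cmod (c k) * cmod (monom_e k w - monom_e k z))"
      unfolding p sum_subtractf[symmetric] right_diff_distrib[symmetric]
      by (rule order_trans[OF norm_sum]) (simp add: norm_mult)
    ultimately have "cmod (p w - p z) \<le> L * D"
      by (simp add: L_def sum_distrib_right mult.assoc)
    then have "(cmod (p w - p z))\<^sup>2 \<le> (L * D)\<^sup>2"
      by (intro power_mono) auto
    also have "\<dots> = L\<^sup>2 * D\<^sup>2" by (simp add: power_mult_distrib)
    also have "\<dots> \<le> L\<^sup>2 * ((\<Sum>j\<in>UNIV. (cmod (w j - z j))\<^sup>2) * CARD('a))"
      unfolding D_def by (intro mult_left_mono sum_squared_le_sum_of_squares) auto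
    finally show ?thesis by (simp add: mult_ac)
  qed
  then show ?thesis by (intro that[of "L\<^sup>2 * CARD('a)"]) auto
qed

text \<open>
  A trigonometric polynomial is Lipschitz on the torus, so that the coordinate distances control its
  oscillation.
\<close>

lemma monom_span_poisson_tendsto:
  fixes z :: "'n::finite \<Rightarrow> complex"
  assumes p: "p \<in> monom_span K" and z: "z \<in> space torus_measure"
  shows "((\<lambda>r. poisson_integral r (\<lambda>w. (cmod (p w - p z))\<^sup>2) z) \<longlongrightarrow> 0) (at_left 1)"
proof -
  interpret T: prob_space "torus_measure :: ('n \<Rightarrow> complex) measure" by (rule prob_space_torus_measure)
  obtain B where B: "0 \<le> B"
    "\<And>w. w \<in> space torus_measure \<Longrightarrow> (cmod (p w - p z))\<^sup>2 \<le> B * (\<Sum>j\<in>UNIV. (cmod (w j - z j))\<^sup>2)"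
    using monom_span_lipschitz[OF p] z by metis
  have ev: "\<forall>\<^sub>F r in at_left (1::real). 0 \<le> r \<and> r < 1"
    using eventually_at_left_real[of 0 1] by (rule eventually_mono) auto
  have "poisson_integral r (\<lambda>w. (cmod (p w - p z))\<^sup>2) z \<le> B * (real CARD('n) * (4 * (1 - r\<^sup>2)))"
    if r: "0 \<le> r" "r < 1" for r :: real
  proof -
    note dist = poisson_integral_coordinate_distance[OF r z]
    have pz: "integrable torus_measure (\<lambda>w. (cmod (p w - p z))\<^sup>2)"
      using square_integrable_sqnorm[OF square_integrable_diff[OF monom_span_square_integrable[OF p], of "\<lambda>_. p z"]]
      by (simp add: square_integrable_def)
    have "poisson_integral r (\<lambda>w. (cmod (p w - p z))\<^sup>2) z
        \<le> poisson_integral r (\<lambda>w. B * (\<Sum>j\<in>UNIV. (cmod (w j - z j))\<^sup>2)) z"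
      by (intro poisson_integral_mono r z pz integrable_mult_right Bochner_Integration.integrable_sum dist(2) B(2))
    also have "\<dots> = B * (\<Sum>j\<in>UNIV. poisson_integral r (\<lambda>w. (cmod (w j - z j))\<^sup>2) z)"
    proof -
      have "poisson_integral r (\<lambda>w. B * (\<Sum>j\<in>UNIV. (cmod (w j - z j))\<^sup>2)) z =
        (LINT w|torus_measure. B * (\<Sum>j\<in>UNIV. poisson_kernel r z w * (cmod (w j - z j))\<^sup>2))"
        by (simp add: poisson_integral_def sum_distrib_left mult_ac)
      also have "\<dots> = B * (\<Sum>j\<in>UNIV. (LINT w|torus_measure. poisson_kernel r z w * (cmod (w j - z j))\<^sup>2))"
        by (subst integral_mult_right_zero, subst Bochner_Integration.integral_sum)
           (auto intro!: integrable_poisson_kernel_mult r z dist(2))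
      finally show ?thesis by (simp add: poisson_integral_def)
    qed
    also have "\<dots> \<le> B * (\<Sum>j\<in>(UNIV::'n set). 4 * (1 - r\<^sup>2))"
      by (intro mult_left_mono sum_mono dist(1) B(1))
    finally show ?thesis by simp
  qed
  then have le: "\<forall>\<^sub>F r in at_left 1. poisson_integral r (\<lambda>w. (cmod (p w - p z))\<^sup>2) z \<le> B * (real CARD('n) * (4 * (1 - r\<^sup>2)))"
    using ev by (auto elim: eventually_mono)
  show ?thesis
  proof (rule tendsto_sandwich[OF _ le tendsto_const])
    show "\<forall>\<^sub>F r in at_left 1. 0 \<le> poisson_integral r (\<lambda>w. (cmod (p w - p z))\<^sup>2) z"
      using ev by (rule eventually_mono) (auto intro: poisson_integral_nonneg)
    have "((\<lambda>r::real. B * (real CARD('n) * (4 * (1 - r\<^sup>2)))) \<longlongrightarrow> B * (real CARD('n) * (4 * (1 - 1\<^sup>2)))) (at_left 1)"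
      by (intro tendsto_intros)
    then show "((\<lambda>r::real. B * (real CARD('n) * (4 * (1 - r\<^sup>2)))) \<longlongrightarrow> 0) (at_left 1)" by simp
  qed
qed

lemma square_norm_sum3:
  fixes a b c :: complex
  shows "(cmod (a + b + c))\<^sup>2 \<le> 3 * (cmod a)\<^sup>2 + 3 * (cmod b)\<^sup>2 + 3 * (cmod c)\<^sup>2"
proof -
  have "cmod (a + b + c) \<le> cmod a + cmod b + cmod c"
    by (intro order_trans[OF norm_triangle_ineq] add_mono norm_triangle_ineq) auto
  then have "(cmod (a + b + c))\<^sup>2 \<le> (cmod a + cmod b + cmod c)\<^sup>2"
    by (intro power_mono) auto
  also have "\<dots> \<le> 3 * (cmod a)\<^sup>2 + 3 * (cmod b)\<^sup>2 + 3 * (cmod c)\<^sup>2"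
    using sum_squares_bound[of "cmod a" "cmod b"] sum_squares_bound[of "cmod a" "cmod c"]
      sum_squares_bound[of "cmod b" "cmod c"]
    by (simp add: power2_eq_square algebra_simps)
  finally show ?thesis .
qed

text \<open>
  For each \<open>m\<close> choose a trigonometric polynomial \<open>p\<close> with \<open>\<parallel>f - p\<parallel>\<^sup>2 < 4 ^ (- m)\<close>.  By the weak type
  estimate and Markov's inequality, both the radial maximal function of \<open>\<bar>f - p\<bar>\<^sup>2\<close> and
  \<open>\<bar>f - p\<bar>\<^sup>2\<close> itself are at most \<open>2 ^ (- m)\<close> outside a set of measure \<open>O(2 ^ (- m))\<close>.  By
  Borel-Cantelli almost every \<open>z\<close> lies in only finitely many of these sets, and at such \<open>z\<close> the claim
  for \<open>f\<close> follows from the one for the polynomials by the triangle inequality.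
\<close>

lemma poisson_lebesgue_points:
  fixes f :: "('n::finite \<Rightarrow> complex) \<Rightarrow> complex"
  assumes f: "f \<in> square_integrable torus_measure"
    and approx: "\<And>\<epsilon>. 0 < \<epsilon> \<Longrightarrow> \<exists>p\<in>monom_span K.
                   sqnorm torus_measure (\<lambda>w. f w - p w) < \<epsilon>"
  shows "AE z in torus_measure.
    ((\<lambda>r. poisson_integral r (\<lambda>w. (cmod (f w - f z))\<^sup>2) z) \<longlongrightarrow> 0) (at_left 1)"
proof -
  interpret T: prob_space "torus_measure :: ('n \<Rightarrow> complex) measure" by (rule prob_space_torus_measure)
  define C :: real where "C = 2 * 9 ^ CARD('n) + 1"
  define P where "P = (\<lambda>(m::nat) p E. p \<in> monom_span K \<and>
      E \<in> sets torus_measure \<and> measure torus_measure E \<le> C * (1/2) ^ m \<and>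
      (\<forall>r z. 1/2 \<le> r \<longrightarrow> r < 1 \<longrightarrow> z \<in> space torus_measure - E \<longrightarrow>
         poisson_integral r (\<lambda>w. (cmod (f w - p w))\<^sup>2) z \<le> (1/2) ^ m \<and> (cmod (f z - p z))\<^sup>2 \<le> (1/2) ^ m))"
  have "\<exists>p E. P m p E" for m
  proof -
    obtain p where p: "p \<in> monom_span K"
      and small: "sqnorm torus_measure (\<lambda>w. f w - p w) < (1/4) ^ m"
      using approx[of "(1/4) ^ m"] by auto
    have fp: "integrable torus_measure (\<lambda>w. (cmod (f w - p w))\<^sup>2)"
      by (intro square_integrable_sqnorm square_integrable_diff f monom_span_square_integrable[OF p])
    then have [measurable]: "(\<lambda>w. (cmod (f w - p w))\<^sup>2) \<in> borel_measurable torus_measure" by simp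
    obtain E where E: "E \<in> sets torus_measure"
      "measure torus_measure E \<le> 2 * 9 ^ CARD('n) * (LINT w|torus_measure. (cmod (f w - p w))\<^sup>2) / (1/2) ^ m"
      "\<And>\<rho> z. \<lbrakk>1/2 \<le> \<rho>; \<rho> < 1; z \<in> space torus_measure - E\<rbrakk>
         \<Longrightarrow> poisson_integral \<rho> (\<lambda>w. (cmod (f w - p w))\<^sup>2) z \<le> (1/2) ^ m"
      using poisson_maximal_weak_type[OF fp, of "(1/2) ^ m"] by auto
    define E' where "E' = {z \<in> space torus_measure. (1/2) ^ m \<le> (cmod (f z - p z))\<^sup>2}"
    have E': "E' \<in> sets torus_measure" unfolding E'_def by measurable
    have q: "(1/4) ^ m / (1/2) ^ m = (1/2 :: real) ^ m"
      by (simp add: power_divide[symmetric])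
    have "measure torus_measure E \<le> 2 * 9 ^ CARD('n) * (1/4) ^ m / (1/2) ^ m"
      using small by (intro order_trans[OF E(2)] divide_right_mono mult_left_mono) (auto simp: sqnorm_def)
    also have "\<dots> = 2 * 9 ^ CARD('n) * (1/2) ^ m"
      by (simp only: q times_divide_eq_right[symmetric])
    finally have mE: "measure torus_measure E \<le> 2 * 9 ^ CARD('n) * (1/2) ^ m" .
    have "measure torus_measure E' \<le> sqnorm torus_measure (\<lambda>w. f w - p w) / (1/2) ^ m"
      unfolding E'_def sqnorm_def by (intro integral_Markov_inequality_measure[OF fp sets.top]) auto
    also have "\<dots> \<le> (1/4) ^ m / (1/2) ^ m"
      using small by (intro divide_right_mono) auto
    finally have mE': "measure torus_measure E' \<le> (1/2) ^ m" unfolding q .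
    have "measure torus_measure (E \<union> E') \<le> measure torus_measure E + measure torus_measure E'"
      by (rule measure_Un_le[OF E(1) E'])
    also have "\<dots> \<le> C * (1/2) ^ m" using mE mE' by (simp add: C_def distrib_right)
    finally have "measure torus_measure (E \<union> E') \<le> C * (1/2) ^ m" .
    moreover have "E \<union> E' \<in> sets torus_measure" using E E' by simp
    moreover have "poisson_integral r (\<lambda>w. (cmod (f w - p w))\<^sup>2) z \<le> (1/2) ^ m" "(cmod (f z - p z))\<^sup>2 \<le> (1/2) ^ m"
      if "1/2 \<le> r" "r < 1" "z \<in> space torus_measure - (E \<union> E')" for r z
    proof -
      show "poisson_integral r (\<lambda>w. (cmod (f w - p w))\<^sup>2) z \<le> (1/2) ^ m"
        using that by (intro E(3)) auto
      show "(cmod (f z - p z))\<^sup>2 \<le> (1/2) ^ m"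
        using that by (simp add: E'_def not_le less_imp_le)
    qed
    ultimately have "P m p (E \<union> E')" using p unfolding P_def by blast
    then show ?thesis by blast
  qed
  then obtain p E where "\<And>m. P m (p m) (E m)" by metis
  then have p: "\<And>m. p m \<in> monom_span K"
    and E: "\<And>m. E m \<in> sets torus_measure" "\<And>m. measure torus_measure (E m) \<le> C * (1/2) ^ m"
    and good: "\<And>m r z. \<lbrakk>1/2 \<le> r; r < 1; z \<in> space torus_measure - E m\<rbrakk> \<Longrightarrow>
         poisson_integral r (\<lambda>w. (cmod (f w - p m w))\<^sup>2) z \<le> (1/2) ^ m \<and> (cmod (f z - p m z))\<^sup>2 \<le> (1/2) ^ m"
    unfolding P_def by blast+
  note p2 = monom_span_square_integrable[OF p]
  have "summable (\<lambda>m. measure torus_measure (E m))"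
    by (rule summable_comparison_test'[of "\<lambda>m. C * (1/2) ^ m" 0])
       (auto intro!: summable_mult summable_geometric E(2))
  then have "AE z in torus_measure. \<forall>\<^sub>F m in sequentially. z \<in> space torus_measure - E m"
    by (intro borel_cantelli_AE1 E(1)) (auto simp: less_top[symmetric])
  then show ?thesis
  proof (rule AE_mp, intro AE_I2 impI)
    fix z :: "'n \<Rightarrow> complex"
    assume z: "z \<in> space torus_measure" and ev: "\<forall>\<^sub>F m in sequentially. z \<in> space torus_measure - E m"
    have near: "\<forall>\<^sub>F r in at_left (1::real). 1/2 \<le> r \<and> r < 1"
      using eventually_at_left_real[of "1/2" 1] by (rule eventually_mono) auto
    show "((\<lambda>r. poisson_integral r (\<lambda>w. (cmod (f w - f z))\<^sup>2) z) \<longlongrightarrow> 0) (at_left 1)"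
    proof (rule order_tendstoI)
      fix a :: real assume "a < 0"
      show "\<forall>\<^sub>F r in at_left 1. a < poisson_integral r (\<lambda>w. (cmod (f w - f z))\<^sup>2) z"
        using near
      proof (rule eventually_mono)
        fix r :: real assume "1/2 \<le> r \<and> r < 1"
        then have "0 \<le> poisson_integral r (\<lambda>w. (cmod (f w - f z))\<^sup>2) z"
          by (intro poisson_integral_nonneg) auto
        then show "a < poisson_integral r (\<lambda>w. (cmod (f w - f z))\<^sup>2) z" using \<open>a < 0\<close> by linarith
      qed
    next
      fix a :: real assume a: "0 < a"
      have "(\<lambda>m. (1/2 :: real) ^ m) \<longlonglongrightarrow> 0" by (rule LIMSEQ_power_zero) simp
      then have "\<forall>\<^sub>F m in sequentially. (1/2 :: real) ^ m < a / 9"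
        using a by (intro order_tendstoD(2)) auto
      then have "\<forall>\<^sub>F m in sequentially. (1/2 :: real) ^ m < a / 9 \<and> z \<in> space torus_measure - E m"
        using ev by (rule eventually_conj)
      then obtain m where m: "(1/2 :: real) ^ m < a / 9" "z \<in> space torus_measure - E m"
        using eventually_happens'[OF sequentially_bot] by blast
      have "\<forall>\<^sub>F r in at_left 1. poisson_integral r (\<lambda>w. (cmod (p m w - p m z))\<^sup>2) z < a / 9"
        using monom_span_poisson_tendsto[OF p z] a by (intro order_tendstoD(2)) auto
      then show "\<forall>\<^sub>F r in at_left 1. poisson_integral r (\<lambda>w. (cmod (f w - f z))\<^sup>2) z < a"
        using near
      proof eventually_elim
        case (elim r)
        then have r: "0 \<le> r" "r < 1" "1/2 \<le> r" by auto
        have i1: "integrable torus_measure (\<lambda>w. 3 * (cmod (f w - p m w))\<^sup>2)"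
          by (intro integrable_mult_right square_integrable_sqnorm square_integrable_diff f p2)
        have const: "(\<lambda>_::'n \<Rightarrow> complex. c) \<in> square_integrable torus_measure" for c
          by (simp add: square_integrable_def)
        have i2: "integrable torus_measure (\<lambda>w. 3 * (cmod (p m w - p m z))\<^sup>2)"
          by (intro integrable_mult_right square_integrable_sqnorm square_integrable_diff const p2)
        have i3: "integrable torus_measure (\<lambda>w::'n \<Rightarrow> complex. 3 * (cmod (f z - p m z))\<^sup>2)"
          by simp
        have scale: "poisson_integral r (\<lambda>w. 3 * u w) z = 3 * poisson_integral r u z" for u
          by (simp add: poisson_integral_def mult.left_commute[of _ 3])
        have "poisson_integral r (\<lambda>w. (cmod (f w - f z))\<^sup>2) z \<le>
          poisson_integral r (\<lambda>w. (3 * (cmod (f w - p m w))\<^sup>2 + 3 * (cmod (p m w - p m z))\<^sup>2) + 3 * (cmod (f z - p m z))\<^sup>2) z"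
        proof (intro poisson_integral_mono r z Bochner_Integration.integrable_add i1 i2 i3)
          show "integrable torus_measure (\<lambda>w. (cmod (f w - f z))\<^sup>2)"
            by (intro square_integrable_sqnorm square_integrable_diff const f)
          show "(cmod (f w - f z))\<^sup>2 \<le> 3 * (cmod (f w - p m w))\<^sup>2 + 3 * (cmod (p m w - p m z))\<^sup>2 + 3 * (cmod (f z - p m z))\<^sup>2" for w
            using square_norm_sum3[of "f w - p m w" "p m w - p m z" "p m z - f z"]
            by (simp add: norm_minus_commute)
        qed
        also have "\<dots> = 3 * poisson_integral r (\<lambda>w. (cmod (f w - p m w))\<^sup>2) z
            + 3 * poisson_integral r (\<lambda>w. (cmod (p m w - p m z))\<^sup>2) z + 3 * (cmod (f z - p m z))\<^sup>2"
          by (subst poisson_integral_add[OF r(1,2) z Bochner_Integration.integrable_add[OF i1 i2] i3],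
              subst poisson_integral_add[OF r(1,2) z i1 i2])
             (simp only: scale poisson_integral_const[OF r(1,2) z])
        also have "\<dots> < a"
          using good[OF r(3,2) m(2)] m(1) elim by linarith
        finally show ?case .
      qed
    qed
  qed
qed

section \<open>The Hardy space projection of a function times the kernel\<close>

text \<open>
  The space \<open>hardy2\<close> is cut out of \<open>L\<^sup>2\<close> by the vanishing of inner products, hence is a closed
  subspace, and the projection theorem supplies a witness for the choice in \<open>hardy2_proj\<close>.
\<close>

lemma hardy2_proj_orthogonal:
  fixes F :: "('n::finite \<Rightarrow> complex) \<Rightarrow> complex"
  assumes F: "F \<in> L2_torus"
  shows "hardy2_proj F \<in> hardy2"
    and "\<And>v. v \<in> hardy2 \<Longrightarrow> L2_inner (\<lambda>z. F z - hardy2_proj F z) v = 0"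
proof -
  interpret prob_space "torus_measure :: ('n \<Rightarrow> complex) measure" by (rule prob_space_torus_measure)
  note e = monom_e_L2[unfolded L2_torus_eq]
  have mem: "f \<in> hardy2 \<longleftrightarrow> f \<in> square_integrable torus_measure \<and>
      (\<forall>k. \<not> (\<forall>j. 0 \<le> k j) \<longrightarrow> inner_prod torus_measure f (monom_e k) = 0)" for f :: "('n \<Rightarrow> complex) \<Rightarrow> complex"
    by (simp add: hardy2_def L2_torus_eq L2_inner_eq)
  have "\<exists>h. h \<in> hardy2 \<and> (\<forall>v\<in>hardy2. L2_inner (\<lambda>z. F z - h z) v = 0)"
  proof (rule square_integrable_projection[of hardy2 F])
    show "(hardy2 :: (('n \<Rightarrow> complex) \<Rightarrow> complex) set) \<subseteq> square_integrable torus_measure" by (auto simp: mem)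
    have "(\<lambda>_::'n \<Rightarrow> complex. 0) \<in> hardy2" by (simp add: mem square_integrable_def inner_prod_def)
    then show "(hardy2 :: (('n \<Rightarrow> complex) \<Rightarrow> complex) set) \<noteq> {}" by blast
    show "F \<in> square_integrable torus_measure" using F by (simp add: L2_torus_eq)
    show "(\<lambda>x. f x + a * g x) \<in> hardy2" if "f \<in> hardy2" "g \<in> hardy2" for f g :: "('n \<Rightarrow> complex) \<Rightarrow> complex" and a
      using that
      by (auto simp: mem inner_prod_add_left square_integrable_cmult inner_prod_cmult_left e
          intro!: square_integrable_add)
    show "h \<in> hardy2"
      if u: "\<And>n::nat. u n \<in> hardy2" and h: "h \<in> square_integrable torus_measure"
        and lim: "(\<lambda>n. sqnorm torus_measure (\<lambda>x. h x - u n x)) \<longlonglongrightarrow> 0"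
      for u and h :: "('n \<Rightarrow> complex) \<Rightarrow> complex"
    proof -
      have "inner_prod torus_measure h (monom_e k) = 0" if k: "\<not> (\<forall>j. 0 \<le> k j)" for k
      proof -
        have "cmod (inner_prod torus_measure h (monom_e k)) \<le> sqrt (sqnorm torus_measure (\<lambda>x. h x - u n x))" for n
        proof -
          have un: "u n \<in> square_integrable torus_measure" using u by (simp add: mem)
          have "inner_prod torus_measure (\<lambda>x. h x - u n x) (monom_e k) = inner_prod torus_measure h (monom_e k)"
            using u[of n] k h by (simp add: inner_prod_diff_left e mem)
          then show ?thesis
            using inner_prod_le_sqrt[OF square_integrable_diff[OF h un] e[of k]] by (simp add: sqnorm_monom_e)
        qed
        moreover have "(\<lambda>n. sqrt (sqnorm torus_measure (\<lambda>x. h x - u n x))) \<longlonglongrightarrow> 0"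
          using tendsto_real_sqrt[OF lim] by simp
        ultimately have "cmod (inner_prod torus_measure h (monom_e k)) \<le> 0"
          by (intro LIMSEQ_le_const) auto
        then show ?thesis by simp
      qed
      then show ?thesis using h by (simp add: mem)
    qed
  qed (auto simp: L2_inner_eq)
  from someI_ex[OF this]
  show "hardy2_proj F \<in> hardy2"
    and "\<And>v. v \<in> hardy2 \<Longrightarrow> L2_inner (\<lambda>z. F z - hardy2_proj F z) v = 0"
    by (auto simp: hardy2_proj_def)
qed

context
  fixes r :: real and \<zeta> :: "'n::finite \<Rightarrow> complex" and k :: "('n \<Rightarrow> complex) \<Rightarrow> complex"
  assumes r: "0 \<le> r" "r < 1" and \<zeta>: "\<zeta> \<in> space torus_measure"
  defines "k \<equiv> norm_kernel (\<lambda>j. complex_of_real r * \<zeta> j)"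
begin

lemma norm_kernel_sq: "(cmod (k w))\<^sup>2 = poisson_kernel r \<zeta> w"
proof -
  have "cmod (complex_of_real r * \<zeta> j) = r" for j
    using r \<zeta> by (simp add: norm_mult space_torus_measure)
  then show ?thesis
    unfolding k_def norm_kernel_def poisson_kernel_def circle_poisson_def
    using r by (simp add: prod_norm[symmetric] norm_divide power_divide prod_power_distrib power_le_one mult.assoc)
qed

lemma borel_measurable_norm_kernel: "k \<in> borel_measurable torus_measure"
  unfolding k_def norm_kernel_def[abs_def] by measurable

lemma norm_kernel_mult_L2:
  assumes f: "f \<in> L2_torus"
  shows "(\<lambda>w. f w * k w) \<in> L2_torus"
    and "sqnorm torus_measure (\<lambda>w. f w * k w) = poisson_integral r (\<lambda>w. (cmod (f w))\<^sup>2) \<zeta>"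
proof -
  have [measurable]: "k \<in> borel_measurable torus_measure" "f \<in> borel_measurable torus_measure"
    using f borel_measurable_norm_kernel by (auto simp: L2_torus_def)
  have eq: "(cmod (f w * k w))\<^sup>2 = poisson_kernel r \<zeta> w * (cmod (f w))\<^sup>2" for w
    by (simp add: norm_mult power_mult_distrib norm_kernel_sq)
  have "integrable torus_measure (\<lambda>w. (cmod (f w * k w))\<^sup>2)"
    unfolding eq using f by (intro integrable_poisson_kernel_mult r \<zeta>) (simp add: L2_torus_def)
  then show "(\<lambda>w. f w * k w) \<in> L2_torus" by (simp add: L2_torus_def)
  show "sqnorm torus_measure (\<lambda>w. f w * k w) = poisson_integral r (\<lambda>w. (cmod (f w))\<^sup>2) \<zeta>"
    unfolding sqnorm_def poisson_integral_def eq ..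
qed

lemma const_L2: "(\<lambda>_::'n \<Rightarrow> complex. c) \<in> L2_torus"
proof -
  interpret prob_space "torus_measure :: ('n \<Rightarrow> complex) measure" by (rule prob_space_torus_measure)
  show ?thesis by (simp add: L2_torus_def)
qed

lemma norm_kernel_L2: "k \<in> L2_torus" and sqnorm_norm_kernel: "sqnorm torus_measure k = 1"
  using norm_kernel_mult_L2[OF const_L2[of 1]] poisson_integral_const[OF r \<zeta>, of 1] by simp_all

text \<open>
  The inner product with \<open>monom_e \<kappa>\<close> factors over the coordinates.  If \<open>\<kappa> i < 0\<close>, the \<open>i\<close>-th
  factor is the mean over the circle of a holomorphic function that vanishes at \<open>0\<close>.
\<close>

lemma norm_kernel_hardy2: "k \<in> hardy2"
proof -
  have "L2_inner k (monom_e \<kappa>) = 0" if "\<not> (\<forall>j. 0 \<le> \<kappa> j)" for \<kappa>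
  proof -
    obtain i where i: "\<kappa> i < 0" using \<open>\<not> (\<forall>j. 0 \<le> \<kappa> j)\<close> by (auto simp: not_le)
    define F where "F = (\<lambda>j w. sqrt (1 - (cmod (r * \<zeta> j))\<^sup>2) / (1 - cnj (r * \<zeta> j) * w) * cnj (w powi \<kappa> j))"
    have nz: "1 - cnj (r * \<zeta> j) * w \<noteq> 0" if "cmod w \<le> 1" for j w
      using one_minus_mult_nonzero[of "cnj (r * \<zeta> j)" w] r \<zeta> that
      by (simp add: norm_mult space_torus_measure)
    have F_int: "integrable circle_measure (F j)" for j
      unfolding F_def using nz
      by (intro integrable_circle_continuous continuous_intros) auto
    have "L2_inner k (monom_e \<kappa>) = (LINT w|torus_measure. (\<Prod>j\<in>UNIV. F j (w j)))"
      unfolding L2_inner_def k_def norm_kernel_def monom_e_def F_def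
      by (simp add: prod.distrib[symmetric])
    also have "\<dots> = (\<Prod>j\<in>UNIV. (LINT w|circle_measure. F j w))"
      by (rule integral_torus_prod[OF F_int])
    also have "(LINT w|circle_measure. F i w) = 0"
    proof -
      define m where "m = nat (- \<kappa> i)"
      define G where "G = (\<lambda>w. sqrt (1 - (cmod (r * \<zeta> i))\<^sup>2) / (1 - cnj (r * \<zeta> i) * w) * w ^ m)"
      have "G holomorphic_on cball 0 1"
        unfolding G_def using nz by (intro holomorphic_intros) auto
      then have "(LINT w|circle_measure. G w / (1 - 0 * cnj w)) = G 0"
        by (rule circle_Cauchy_formula) simp
      moreover have "G 0 = 0" using i by (simp add: G_def m_def)
      moreover have "(LINT w|circle_measure. F i w) = (LINT w|circle_measure. G w)"
      proof (rule Bochner_Integration.integral_cong[OF refl])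
        fix w assume "w \<in> space circle_measure"
        then have "w * cnj w = 1" by (simp add: complex_norm_square[symmetric])
        then have "inverse w = cnj w" by (rule inverse_unique)
        then have "cnj (w powi \<kappa> i) = w ^ m"
          using i by (simp add: power_int_def m_def)
        then show "F i w = G w" by (simp add: F_def G_def)
      qed
      ultimately show ?thesis by simp
    qed
    then have "(\<Prod>j\<in>UNIV. (LINT w|circle_measure. F j w)) = 0"
      by (intro prod_zero) auto
    finally show ?thesis .
  qed
  then show ?thesis using norm_kernel_L2 by (simp add: hardy2_def)
qed

text \<open>
  Since \<open>k\<close> belongs to \<open>hardy2\<close>, \<open>h\<close> is the projection of \<open>(f - c) k\<close>, so its norm is at most that
  of \<open>(f - c) k\<close>.  The argument uses only membership in \<open>hardy2\<close> and the orthogonality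
  relation, and thus applies to whichever representative \<open>hardy2_proj\<close> selects.
\<close>

lemma hardy2_proj_minus_multiple:
  fixes c :: complex
  assumes f: "f \<in> L2_torus"
  defines "h \<equiv> \<lambda>z. hardy2_proj (\<lambda>w. f w * k w) z - c * k z"
  shows "h \<in> L2_torus"
    and "sqnorm torus_measure h \<le> poisson_integral r (\<lambda>w. (cmod (f w - c))\<^sup>2) \<zeta>"
proof -
  define p where "p = hardy2_proj (\<lambda>w. f w * k w)"
  note fk = norm_kernel_mult_L2[OF f]
  have p: "p \<in> hardy2" and orth: "\<And>v. v \<in> hardy2 \<Longrightarrow> L2_inner (\<lambda>z. f z * k z - p z) v = 0"
    using hardy2_proj_orthogonal[OF fk(1)] by (auto simp: p_def)
  have p2: "p \<in> square_integrable torus_measure" and k2: "k \<in> square_integrable torus_measure"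
    using p norm_kernel_L2 by (auto simp: hardy2_def L2_torus_eq)
  have h2: "h \<in> square_integrable torus_measure"
    unfolding h_def p_def[symmetric] by (intro square_integrable_diff square_integrable_cmult p2 k2)
  then show "h \<in> L2_torus" by (simp add: L2_torus_eq)
  have hH: "h \<in> hardy2"
    using p norm_kernel_hardy2 h2
    by (auto simp: hardy2_def L2_torus_eq L2_inner_eq h_def p_def[symmetric] inner_prod_diff_left
        inner_prod_cmult_left square_integrable_cmult monom_e_L2[unfolded L2_torus_eq])
  have fc: "(\<lambda>w. f w - c) \<in> L2_torus"
    using square_integrable_diff[of f torus_measure "\<lambda>_. c"] f const_L2[of c] by (simp add: L2_torus_eq)
  note fck = norm_kernel_mult_L2[OF fc]
  have fck2: "(\<lambda>w. (f w - c) * k w) \<in> square_integrable torus_measure"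
    using fck(1) by (simp add: L2_torus_eq)
  have "inner_prod torus_measure (\<lambda>w. (f w - c) * k w) h - inner_prod torus_measure h h =
        inner_prod torus_measure (\<lambda>w. (f w - c) * k w - h w) h"
    by (simp add: inner_prod_diff_left[OF fck2 h2 h2])
  also have "\<dots> = L2_inner (\<lambda>z. f z * k z - p z) h"
    by (simp add: L2_inner_eq h_def p_def algebra_simps)
  also have "\<dots> = 0" by (rule orth[OF hH])
  finally have "inner_prod torus_measure (\<lambda>w. (f w - c) * k w) h = of_real (sqnorm torus_measure h)"
    by (simp add: inner_prod_self)
  then have "(sqnorm torus_measure h)\<^sup>2 \<le> sqnorm torus_measure (\<lambda>w. (f w - c) * k w) * sqnorm torus_measure h"
    using inner_prod_cauchy_schwarz[OF fck2 h2] by simp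
  then have "sqnorm torus_measure h \<le> sqnorm torus_measure (\<lambda>w. (f w - c) * k w)"
    using sqnorm_nonneg[of torus_measure h] sqnorm_nonneg[of torus_measure "\<lambda>w. (f w - c) * k w"]
    by (cases "sqnorm torus_measure h = 0") (auto simp: power2_eq_square)
  then show "sqnorm torus_measure h \<le> poisson_integral r (\<lambda>w. (cmod (f w - c))\<^sup>2) \<zeta>"
    using fck(2) by simp
qed

text \<open>
  Expand the inner product of \<open>c k + a\<close> and \<open>d k + b\<close>, where \<open>k\<close> has norm \<open>1\<close> and the remainders \<open>a\<close> and
  \<open>b\<close> have norms at most \<open>A\<close> and \<open>B\<close>.
\<close>

lemma inner_hardy2_proj_approx:
  fixes c d :: complex
  assumes f: "f \<in> L2_torus" and g: "g \<in> L2_torus"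
  defines "A \<equiv> sqrt (poisson_integral r (\<lambda>w. (cmod (f w - c))\<^sup>2) \<zeta>)"
    and "B \<equiv> sqrt (poisson_integral r (\<lambda>w. (cmod (g w - d))\<^sup>2) \<zeta>)"
  shows "cmod (L2_inner (hardy2_proj (\<lambda>w. f w * k w)) (hardy2_proj (\<lambda>w. g w * k w)) - c * cnj d)
           \<le> cmod c * B + cmod d * A + A * B"
proof -
  define a where "a = (\<lambda>z. hardy2_proj (\<lambda>w. f w * k w) z - c * k z)"
  define b where "b = (\<lambda>z. hardy2_proj (\<lambda>w. g w * k w) z - d * k z)"
  have a: "a \<in> square_integrable torus_measure" "sqrt (sqnorm torus_measure a) \<le> A"
    using hardy2_proj_minus_multiple[OF f, of c] by (auto simp: a_def A_def L2_torus_eq)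
  have b: "b \<in> square_integrable torus_measure" "sqrt (sqnorm torus_measure b) \<le> B"
    using hardy2_proj_minus_multiple[OF g, of d] by (auto simp: b_def B_def L2_torus_eq)
  have k2: "k \<in> square_integrable torus_measure"
    using norm_kernel_L2 by (simp add: L2_torus_eq)
  note ck = square_integrable_cmult[OF k2, of c] and dk = square_integrable_cmult[OF k2, of d]
  have A0: "0 \<le> sqrt (sqnorm torus_measure a)" and B0: "0 \<le> sqrt (sqnorm torus_measure b)"
    by (simp_all add: sqnorm_nonneg)
  have "L2_inner (hardy2_proj (\<lambda>w. f w * k w)) (hardy2_proj (\<lambda>w. g w * k w)) =
        inner_prod torus_measure (\<lambda>z. c * k z + a z) (\<lambda>z. d * k z + b z)"
    by (simp add: L2_inner_eq a_def b_def)
  also have "\<dots> = c * cnj d + (c * inner_prod torus_measure k b + cnj d * inner_prod torus_measure a k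
      + inner_prod torus_measure a b)"
    by (subst inner_prod_add_left[OF ck a(1) square_integrable_add[OF dk b(1)]],
        subst inner_prod_add_right[OF dk b(1) ck], subst inner_prod_add_right[OF dk b(1) a(1)])
       (simp add: inner_prod_cmult_left inner_prod_cmult_right inner_prod_self sqnorm_norm_kernel algebra_simps)
  finally have "cmod (L2_inner (hardy2_proj (\<lambda>w. f w * k w)) (hardy2_proj (\<lambda>w. g w * k w)) - c * cnj d) =
     cmod (c * inner_prod torus_measure k b + cnj d * inner_prod torus_measure a k + inner_prod torus_measure a b)"
    by simp
  also have "\<dots> \<le> cmod c * cmod (inner_prod torus_measure k b) + cmod d * cmod (inner_prod torus_measure a k)
      + cmod (inner_prod torus_measure a b)"
    by (intro order_trans[OF norm_triangle_ineq] add_mono order_trans[OF norm_triangle_ineq])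
       (simp_all add: norm_mult)
  also have "\<dots> \<le> cmod c * B + cmod d * A + A * B"
  proof (intro add_mono mult_left_mono)
    show "cmod (inner_prod torus_measure k b) \<le> B"
      using inner_prod_le_sqrt[OF k2 b(1)] b(2) by (simp add: sqnorm_norm_kernel)
    show "cmod (inner_prod torus_measure a k) \<le> A"
      using inner_prod_le_sqrt[OF a(1) k2] a(2) by (simp add: sqnorm_norm_kernel)
    have "sqrt (sqnorm torus_measure a) * sqrt (sqnorm torus_measure b) \<le> A * B"
      using a(2) b(2) A0 B0 by (intro mult_mono order_trans[OF A0 a(2)])
    then show "cmod (inner_prod torus_measure a b) \<le> A * B"
      using inner_prod_le_sqrt[OF a(1) b(1)] by linarith
  qed auto
  finally show ?thesis .
qed

end

section \<open>Radial limits\<close>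

lemma hardy2_sign_approx:
  assumes f: "f \<in> hardy2_sign \<alpha>" and \<epsilon>: "0 < \<epsilon>"
  shows "\<exists>p\<in>monom_span (sign_indices \<alpha>). sqnorm torus_measure (\<lambda>w. f w - p w) < \<epsilon>"
proof -
  have "0 < sqrt \<epsilon>" using \<epsilon> by simp
  then obtain p where p: "p \<in> monom_span (sign_indices \<alpha>)" "L2_norm (\<lambda>w. f w - p w) < sqrt \<epsilon>"
    using f unfolding hardy2_sign_def by blast
  then have "sqnorm torus_measure (\<lambda>w. f w - p w) < \<epsilon>"
    by (simp add: L2_norm_def sqnorm_def)
  then show ?thesis using p by blast
qed

theorem theorem3p4:
  fixes \<alpha> \<beta> :: "'n::finite \<Rightarrow> int"
    and f g :: "('n \<Rightarrow> complex) \<Rightarrow> complex"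
  assumes "\<And>j. \<alpha> j \<in> {-1, 1}" and "\<And>j. \<beta> j \<in> {-1, 1}"
    and "f \<in> hardy2_sign \<alpha>" and "g \<in> hardy2_sign \<beta>"
  shows "tends_radially
           (\<lambda>\<xi>. L2_inner (hardy2_proj (\<lambda>\<zeta>. f \<zeta> * norm_kernel \<xi> \<zeta>))
                          (hardy2_proj (\<lambda>\<zeta>. g \<zeta> * norm_kernel \<xi> \<zeta>)))
           (\<lambda>\<zeta>. f \<zeta> * cnj (g \<zeta>))"
proof -
  have f: "f \<in> L2_torus" and g: "g \<in> L2_torus"
    using assms(3,4) by (auto simp: hardy2_sign_def)
  have "AE z in torus_measure.
      ((\<lambda>r. poisson_integral r (\<lambda>w. (cmod (f w - f z))\<^sup>2) z) \<longlongrightarrow> 0) (at_left 1)"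
    by (rule poisson_lebesgue_points[OF _ hardy2_sign_approx[OF assms(3)]])
       (use f in \<open>simp_all add: L2_torus_eq\<close>)
  moreover have "AE z in torus_measure.
      ((\<lambda>r. poisson_integral r (\<lambda>w. (cmod (g w - g z))\<^sup>2) z) \<longlongrightarrow> 0) (at_left 1)"
    by (rule poisson_lebesgue_points[OF _ hardy2_sign_approx[OF assms(4)]])
       (use g in \<open>simp_all add: L2_torus_eq\<close>)
  moreover have "AE z in torus_measure. z \<in> space (torus_measure :: ('n \<Rightarrow> complex) measure)"
    by (rule AE_space)
  ultimately show ?thesis
    unfolding tends_radially_def
  proof eventually_elim
    case (elim z)
    define A where "A = (\<lambda>r. sqrt (poisson_integral r (\<lambda>w. (cmod (f w - f z))\<^sup>2) z))"
    define B where "B = (\<lambda>r. sqrt (poisson_integral r (\<lambda>w. (cmod (g w - g z))\<^sup>2) z))"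
    have A: "(A \<longlongrightarrow> 0) (at_left 1)" and B: "(B \<longlongrightarrow> 0) (at_left 1)"
      unfolding A_def B_def using tendsto_real_sqrt[OF elim(1)] tendsto_real_sqrt[OF elim(2)] by simp_all
    have "\<forall>\<^sub>F r in at_left (1::real). 0 < r \<and> r < 1"
      using eventually_at_left_real[of 0 1] by (rule eventually_mono) auto
    then have bound: "\<forall>\<^sub>F r in at_left 1.
        norm (L2_inner (hardy2_proj (\<lambda>w. f w * norm_kernel (\<lambda>j. complex_of_real r * z j) w))
                       (hardy2_proj (\<lambda>w. g w * norm_kernel (\<lambda>j. complex_of_real r * z j) w)) - f z * cnj (g z))
        \<le> cmod (f z) * B r + cmod (g z) * A r + A r * B r"
      by (rule eventually_mono)
         (use inner_hardy2_proj_approx[OF _ _ elim(3) f g] in \<open>auto simp: A_def B_def\<close>)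
    have "((\<lambda>r. cmod (f z) * B r + cmod (g z) * A r + A r * B r) \<longlongrightarrow>
        cmod (f z) * 0 + cmod (g z) * 0 + 0 * 0) (at_left 1)"
      by (intro tendsto_intros A B)
    then have "((\<lambda>r. L2_inner (hardy2_proj (\<lambda>w. f w * norm_kernel (\<lambda>j. complex_of_real r * z j) w))
                       (hardy2_proj (\<lambda>w. g w * norm_kernel (\<lambda>j. complex_of_real r * z j) w)) - f z * cnj (g z))
        \<longlongrightarrow> 0) (at_left 1)"
      by (intro Lim_null_comparison[OF bound]) simp
    then show ?case by (rule LIM_zero_cancel)
  qed
qed

end
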